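(* Let $H$ be a real Hilbert space, let $Q\colon H\to H$ be monotone and Lipschitz continuous with $\operatorname{zer} Q:=\{x\in H : Q(x)=0\}\neq\emptyset$, and let $x^*\in\operatorname{zer}Q$. Let $t_0>0$, $\alpha\ge 2$, $\eta\in(0,1)$, $\theta:=(1-\eta)+\eta(\alpha-1)$, let $\beta\colon[t_0,+\infty)\to(0,+\infty)$ be continuously differentiable, and set $$b(t):=(1-\eta)\dot\beta(t)+\theta\,\frac{\beta(t)}{t},\qquad t\ge t_0.$$ Let $x\colon[t_0,+\infty)\to H$ be a (strong) solution trajectory of $$\ddot x(t)+\frac{\alpha}{t}\dot x(t)+\beta(t)\frac{d}{dt}Q(x(t))+b(t)Q(x(t))=0,\qquad t\ge t_0.$$ Suppose that for some $\varepsilon\in[0,\alpha-2]$ $$0\le\frac{\dot\beta(t)\,t}{\beta(t)}\le\alpha-2-\varepsilon\qquad\text{for all }t\ge t_0.$$ Then, as $t\to+\infty$, $$\langle Q(x(t)),x(t)-x^*\rangle=\mathcal O\Big(\frac1{t\beta(t)}\Big)\quad\text{and}\quad\|Q(x(t))\|=\mathcal O\Big(\frac1{t\beta(t)}\Big).$$ Additionally, if $\alpha>2$ and $\varepsilon>0$, then the following hold: (i) $\displaystyle\int_{t_0}^{\infty}\beta(t)\langle Q(x(t)),x(t)-x^*\rangle\,dt<+\infty$, $\displaystyle\int_{t_0}^{\infty}t\,\beta(t)^2\|Q(x(t))\|^2\,dt<+\infty$, and $\displaystyle\int_{t_0}^{\infty}t\,\|\dot x(t)\|^2\,dt<+\infty$.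 (ii) $x(t)$ converges weakly to a zero of $Q$ as $t\to+\infty$. (iii) As $t\to+\infty$, $$\langle Q(x(t)),x(t)-x^*\rangle=o\Big(\frac1{t\beta(t)}\Big),\qquad\|Q(x(t))\|=o\Big(\frac1{t\beta(t)}\Big),\qquad\|\dot x(t)\|=o\Big(\frac1t\Big).$$
   Context: A (strong global) solution trajectory is a function $x\colon[t_0,+\infty)\to H$ such that $x$ and $\dot x$ are locally absolutely continuous on $[t_0,+\infty)$ and the differential equation holds for almost every $t\ge t_0$. Since $Q$ is Lipschitz, $t\mapsto Q(x(t))$ is then locally absolutely continuous, so $\frac{d}{dt}Q(x(t))$ exists for almost every $t$. An operator $Q\colon H\to H$ is monotone if $\langle Q(x)-Q(y),x-y\rangle\ge0$ for all $x,y\in H$. Since $\dot x$ has a continuous representative, the rate for $\|\dot x(t)\|$ refers to it. *)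

theory Defs
  imports "HOL-Analysis.Analysis" "HOL-Library.Landau_Symbols"
begin

definition monotone_operator :: "('a::real_inner \<Rightarrow> 'a) \<Rightarrow> bool" where
  "monotone_operator Q \<longleftrightarrow> (\<forall>x y. 0 \<le> (Q x - Q y) \<bullet> (x - y))"

definition zer :: "('a::zero \<Rightarrow> 'a) \<Rightarrow> 'a set" where
  "zer Q = {x. Q x = 0}"

(* A pair (u, v) in D stands for the interval [u, v]; the intervals may share endpoints. *)
definition absolutely_continuous_on ::
    "real set \<Rightarrow> (real \<Rightarrow> 'a::real_normed_vector) \<Rightarrow> bool" where
  "absolutely_continuous_on S f \<longleftrightarrow>
     (\<forall>e>0. \<exists>d>0. \<forall>D.
        finite D \<and>
        (\<forall>(u, v)\<in>D. u \<le> v \<and> {u..v} \<subseteq> S) \<and>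
        disjoint_family_on (\<lambda>(u, v). {u<..<v}) D \<and>
        (\<Sum>(u, v)\<in>D. v - u) < d \<longrightarrow>
        (\<Sum>(u, v)\<in>D. norm (f v - f u)) < e)"

definition locally_absolutely_continuous_on ::
    "real set \<Rightarrow> (real \<Rightarrow> 'a::real_normed_vector) \<Rightarrow> bool" where
  "locally_absolutely_continuous_on S f \<longleftrightarrow>
     (\<forall>a b. {a..b} \<subseteq> S \<longrightarrow> absolutely_continuous_on {a..b} f)"

(* Weak convergence in a Hilbert space, where every continuous linear functional is
   an inner product with a fixed vector. *)
definition weakly_tendsto :: "('b \<Rightarrow> 'a::real_inner) \<Rightarrow> 'a \<Rightarrow> 'b filter \<Rightarrow> bool" where
  "weakly_tendsto x l F \<longleftrightarrow> (\<forall>y. ((\<lambda>t. x t \<bullet> y) \<longlongrightarrow> l \<bullet> y) F)"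

(* Strong global solution of
     x'' + (alpha / t) x' + beta (d/dt) Q(x) + b Q(x) = 0   on [t0, +oo).
   The function v is the locally absolutely continuous representative of x'.  That the
   equation holds at t includes the existence of the derivatives occurring in it. *)
definition strong_solution ::
    "real \<Rightarrow> real \<Rightarrow> (real \<Rightarrow> real) \<Rightarrow> (real \<Rightarrow> real) \<Rightarrow> ('a::real_inner \<Rightarrow> 'a) \<Rightarrow>
     (real \<Rightarrow> 'a) \<Rightarrow> (real \<Rightarrow> 'a) \<Rightarrow> bool" where
  "strong_solution t0 \<alpha> \<beta> b Q x v \<longleftrightarrow>
     locally_absolutely_continuous_on {t0..} x \<and>
     locally_absolutely_continuous_on {t0..} v \<and>
     (AE t in lborel. t \<ge> t0 \<longrightarrow> (x has_vector_derivative v t) (at t within {t0..})) \<and>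
     (AE t in lborel. t \<ge> t0 \<longrightarrow>
        (\<exists>a q. (v has_vector_derivative a) (at t within {t0..}) \<and>
               ((\<lambda>s. Q (x s)) has_vector_derivative q) (at t within {t0..}) \<and>
               a + (\<alpha> / t) *\<^sub>R v t + \<beta> t *\<^sub>R q + b t *\<^sub>R Q (x t) = 0))"

end

theory Submission
  imports Defs
begin

text \<open>
Write \<open>u = Q \<circ> x\<close>, \<open>p = x - z\<close> for a zero \<open>z\<close> of \<open>Q\<close>, and \<open>g = t \<beta> u\<close>.  The coefficient \<open>b\<close> is chosen
such that multiplying the equation by \<open>t\<close> gives
\<open>(t x' + g)' = - (\<alpha> - 1) x' - \<eta> \<delta> u\<close>, where \<open>\<delta> = (\<alpha> - 2) \<beta> - t \<beta>'\<close>; the upper growth bound says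
precisely that \<open>\<delta> \<ge> \<epsilon> \<beta>\<close>.  For a parameter \<open>\<kappa>\<close> between \<open>0\<close> and \<open>\<alpha> - 1\<close> consider the energy
\<open>E\<^sub>\<kappa> = 1/2 \<parallel>\<kappa> p + t x' + (1 - \<eta>) g\<parallel>\<^sup>2 + \<kappa> (\<alpha> - 1 - \<kappa>) / 2 \<parallel>p\<parallel>\<^sup>2 + \<kappa> \<eta> \<langle>p, g\<rangle> + \<eta> (1 - \<eta>) / 2 \<parallel>g\<parallel>\<^sup>2\<close>.
The last three terms cancel the multiples of \<open>\<langle>p, x'\<rangle>\<close>, \<open>\<langle>p, g'\<rangle>\<close> and \<open>\<langle>g, g'\<rangle>\<close> in the derivative of the first, and
what remains is
\<open>E\<^sub>\<kappa>' = - (\<alpha> - 1 - \<kappa>) t (\<parallel>x'\<parallel>\<^sup>2 + \<beta> \<langle>x', u\<rangle>) - \<kappa> \<eta> \<delta> \<langle>p, u\<rangle> - \<eta> (1 - \<eta>) \<delta> \<beta> t \<parallel>u\<parallel>\<^sup>2 - \<eta> t\<^sup>2 \<beta> \<langle>x', u'\<rangle>\<close>.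
By monotonicity of \<open>Q\<close>, both \<open>\<langle>p, u\<rangle>\<close> and \<open>\<langle>x', u'\<rangle>\<close> are nonnegative.

Only the two extreme parameters are used.  For \<open>\<kappa> = \<alpha> - 1\<close> the first summand vanishes, so the energy does
not increase; its third and fourth term give the two big-O rates, and for \<open>\<epsilon> > 0\<close> its total decrease bounds the
integrals of \<open>\<beta> \<langle>p, u\<rangle>\<close> and \<open>t \<beta>\<^sup>2 \<parallel>u\<parallel>\<^sup>2\<close>.  For \<open>\<kappa> = 0\<close>, completing the square bounds the derivative by
\<open>(\<alpha> - 1) / 2 (t \<beta>\<^sup>2 \<parallel>u\<parallel>\<^sup>2 - t \<parallel>x'\<parallel>\<^sup>2)\<close>.  Since the positive part is integrable, so is \<open>t \<parallel>x'\<parallel>\<^sup>2\<close>.  Moreover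
\<open>E\<^sub>0 / t\<close> is dominated by \<open>t \<parallel>x'\<parallel>\<^sup>2 + 2 t \<beta>\<^sup>2 \<parallel>u\<parallel>\<^sup>2\<close>, hence integrable, and as \<open>1 / t\<close> is not integrable,
\<open>E\<^sub>0\<close> comes close to zero again and again; being almost nonincreasing, it tends to zero.  This yields the
little-o rates for \<open>u\<close> and \<open>x'\<close>, and for \<open>\<langle>p, u\<rangle>\<close> because the trajectory is bounded.

For the weak convergence, \<open>E\<^sub>\<kappa>\<close> with \<open>\<kappa> = \<alpha> - 1\<close> converges and all its parts except
\<open>\<kappa>\<^sup>2 / 2 \<parallel>p\<parallel>\<^sup>2\<close> tend to zero, so the distance to every zero converges.  Every weak cluster
point is a zero of \<open>Q\<close> since \<open>Q (x t)\<close> tends to zero, and Opial's argument finishes the proof.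

The energy is merely absolutely continuous and its derivative exists almost everywhere, so its decrease
rests on the fact that an absolutely continuous function with nonpositive derivative almost everywhere is
nonincreasing (\<open>absolutely_continuous_nonincreasing\<close>).
\<close>

section \<open>Absolutely continuous functions\<close>

text \<open>All closure properties below are instances of this comparison: sums, products and Lipschitz images
have increments controlled by those of their constituents.\<close>

lemma absolutely_continuous_on_dominated:
  assumes g: "absolutely_continuous_on S g" and h: "absolutely_continuous_on S h"
    and C: "C \<ge> 0"
    and bound: "\<And>u w. u \<le> w \<Longrightarrow> {u..w} \<subseteq> S \<Longrightarrow>
      norm (f w - f u) \<le> C * (norm (g w - g u) + norm (h w - h u))"
  shows "absolutely_continuous_on S f"
  unfolding absolutely_continuous_on_def
proof (intro allI impI)
  fix e :: real assume "e > 0"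
  define r where "r = e / (2 * (C + 1))"
  have r: "r > 0" using \<open>e > 0\<close> C by (simp add: r_def)
  obtain d1 where d1: "d1 > 0" "\<And>D. finite D \<and> (\<forall>(u, w)\<in>D. u \<le> w \<and> {u..w} \<subseteq> S) \<and>
        disjoint_family_on (\<lambda>(u, w). {u<..<w}) D \<and> (\<Sum>(u, w)\<in>D. w - u) < d1 \<Longrightarrow>
        (\<Sum>(u, w)\<in>D. norm (g w - g u)) < r"
    using g r unfolding absolutely_continuous_on_def by meson
  obtain d2 where d2: "d2 > 0" "\<And>D. finite D \<and> (\<forall>(u, w)\<in>D. u \<le> w \<and> {u..w} \<subseteq> S) \<and>
        disjoint_family_on (\<lambda>(u, w). {u<..<w}) D \<and> (\<Sum>(u, w)\<in>D. w - u) < d2 \<Longrightarrow>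
        (\<Sum>(u, w)\<in>D. norm (h w - h u)) < r"
    using h r unfolding absolutely_continuous_on_def by meson
  have "(\<Sum>(u, w)\<in>D. norm (f w - f u)) < e"
    if D: "finite D" "\<forall>(u, w)\<in>D. u \<le> w \<and> {u..w} \<subseteq> S"
      "disjoint_family_on (\<lambda>(u, w). {u<..<w}) D" "(\<Sum>(u, w)\<in>D. w - u) < min d1 d2" for D
  proof -
    have "(\<Sum>(u, w)\<in>D. norm (f w - f u))
        \<le> (\<Sum>(u, w)\<in>D. C * (norm (g w - g u) + norm (h w - h u)))"
      using D(2) bound by (intro sum_mono) auto
    also have "\<dots> = C * ((\<Sum>(u, w)\<in>D. norm (g w - g u)) + (\<Sum>(u, w)\<in>D. norm (h w - h u)))"
      by (simp add: sum_distrib_left sum.distrib split_beta distrib_left)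
    also have "\<dots> \<le> C * (r + r)"
      using d1(2)[of D] d2(2)[of D] D C by (intro mult_left_mono add_mono) auto
    also have "\<dots> < e"
    proof -
      have "C * (r + r) = e * (C / (C + 1))"
        proof -
        have "C * (r + r) = C * (2 * r)" by simp
        also have "2 * r = e / (C + 1)" using C by (simp add: r_def field_simps)
        finally show ?thesis by simp
      qed
      also have "\<dots> < e" using C \<open>e > 0\<close> by (simp add: field_simps)
      finally show ?thesis .
    qed
    finally show ?thesis .
  qed
  then show "\<exists>d>0. \<forall>D. finite D \<and> (\<forall>(u, v)\<in>D. u \<le> v \<and> {u..v} \<subseteq> S) \<and>
        disjoint_family_on (\<lambda>(u, v). {u<..<v}) D \<and> (\<Sum>(u, v)\<in>D. v - u) < d \<longrightarrow>
        (\<Sum>(u, v)\<in>D. norm (f v - f u)) < e"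
    using d1(1) d2(1) by (intro exI[of _ "min d1 d2"]) auto
qed

lemma absolutely_continuous_on_ident: "absolutely_continuous_on S (\<lambda>t::real. t)"
  unfolding absolutely_continuous_on_def
proof (intro allI impI)
  fix e :: real assume "e > 0"
  moreover have "(\<Sum>(u, w)\<in>D. norm (w - u)) = (\<Sum>(u, w)\<in>D. w - u)"
    if "\<forall>(u, w)\<in>D. u \<le> w \<and> {u..w} \<subseteq> S" for D :: "(real \<times> real) set"
    using that by (intro sum.cong) auto
  ultimately show "\<exists>d>0. \<forall>D. finite D \<and> (\<forall>(u, v)\<in>D. u \<le> v \<and> {u..v} \<subseteq> S) \<and>
        disjoint_family_on (\<lambda>(u, v). {u<..<v}) D \<and> (\<Sum>(u, v)\<in>D. v - u) < d \<longrightarrow>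
        (\<Sum>(u, v)\<in>D. norm (v - u)) < e"
    by (intro exI[of _ e]) auto
qed

lemma absolutely_continuous_on_lipschitz:
  fixes f :: "real \<Rightarrow> 'a::real_normed_vector"
  assumes "L-lipschitz_on S f"
  shows "absolutely_continuous_on S f"
proof (rule absolutely_continuous_on_dominated[OF absolutely_continuous_on_ident
      absolutely_continuous_on_ident lipschitz_on_nonneg[OF assms]])
  fix u w :: real assume "u \<le> w" "{u..w} \<subseteq> S"
  then have "w \<in> S" "u \<in> S" by auto
  then have "norm (f w - f u) \<le> L * norm (w - u)"
    using lipschitz_onD[OF assms, of w u] by (simp add: dist_norm)
  also have "\<dots> \<le> L * (norm (w - u) + norm (w - u))"
    using lipschitz_on_nonneg[OF assms] by (intro mult_left_mono) auto
  finally show "norm (f w - f u) \<le> L * (norm (w - u) + norm (w - u))" .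
qed

lemma absolutely_continuous_on_lipschitz_compose:
  assumes "L-lipschitz_on UNIV g" "absolutely_continuous_on S f"
  shows "absolutely_continuous_on S (\<lambda>t. g (f t))"
proof (rule absolutely_continuous_on_dominated[OF assms(2) assms(2) lipschitz_on_nonneg[OF assms(1)]])
  fix u w :: real
  have "norm (g (f w) - g (f u)) \<le> L * norm (f w - f u)"
    using lipschitz_onD[OF assms(1), of "f w" "f u"] by (auto simp: dist_norm)
  also have "\<dots> \<le> L * (norm (f w - f u) + norm (f w - f u))"
    using lipschitz_on_nonneg[OF assms(1)] by (intro mult_left_mono) auto
  finally show "norm (g (f w) - g (f u)) \<le> L * (norm (f w - f u) + norm (f w - f u))" .
qed

lemma absolutely_continuous_on_add:
  assumes "absolutely_continuous_on S f" "absolutely_continuous_on S g"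
  shows "absolutely_continuous_on S (\<lambda>t. f t + g t)"
proof (rule absolutely_continuous_on_dominated[OF assms, of 1])
  fix u w :: real
  show "norm (f w + g w - (f u + g u)) \<le> 1 * (norm (f w - f u) + norm (g w - g u))"
    using norm_triangle_ineq[of "f w - f u" "g w - g u"] by (simp add: algebra_simps)
qed simp

lemma absolutely_continuous_on_const: "absolutely_continuous_on S (\<lambda>t. c)"
  by (rule absolutely_continuous_on_lipschitz[of 0]) (simp add: lipschitz_on_def)

lemma absolutely_continuous_on_imp_continuous_on:
  assumes "absolutely_continuous_on {a..b} f"
  shows "continuous_on {a..b} f"
  unfolding continuous_on_iff
proof (intro ballI allI impI)
  fix x e :: real assume x: "x \<in> {a..b}" and "e > 0"
  then obtain d where d: "d > 0" "\<And>D. finite D \<and> (\<forall>(u, w)\<in>D. u \<le> w \<and> {u..w} \<subseteq> {a..b}) \<and>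
        disjoint_family_on (\<lambda>(u, w). {u<..<w}) D \<and> (\<Sum>(u, w)\<in>D. w - u) < d \<Longrightarrow>
        (\<Sum>(u, w)\<in>D. norm (f w - f u)) < e"
    using assms unfolding absolutely_continuous_on_def by meson
  have *: "norm (f w - f u) < e" if "u \<le> w" "w - u < d" "u \<in> {a..b}" "w \<in> {a..b}" for u w
    using d(2)[of "{(u, w)}"] that by (auto simp: disjoint_family_on_def)
  have "dist (f y) (f x) < e" if "y \<in> {a..b}" "dist y x < d" for y
    using *[of x y] *[of y x] x that
    by (cases "x \<le> y") (auto simp: dist_norm norm_minus_commute)
  then show "\<exists>d>0. \<forall>y\<in>{a..b}. dist y x < d \<longrightarrow> dist (f y) (f x) < e"
    using d(1) by blast
qed

lemma (in bounded_bilinear) absolutely_continuous_on: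
  assumes f: "absolutely_continuous_on {s..t} f" and g: "absolutely_continuous_on {s..t} g"
  shows "absolutely_continuous_on {s..t} (\<lambda>x. prod (f x) (g x))"
proof -
  obtain K where K: "K > 0" "\<And>x y. norm (prod x y) \<le> norm x * norm y * K"
    using pos_bounded by blast
  have "bounded (f ` {s..t})" "bounded (g ` {s..t})"
    using f g by (auto intro!: compact_imp_bounded compact_continuous_image
        absolutely_continuous_on_imp_continuous_on)
  then obtain B C where B: "B > 0" "\<And>x. x \<in> {s..t} \<Longrightarrow> norm (f x) \<le> B"
    and C: "C > 0" "\<And>x. x \<in> {s..t} \<Longrightarrow> norm (g x) \<le> C"
    unfolding bounded_pos by blast
  show ?thesis
  proof (rule absolutely_continuous_on_dominated[OF f g, of "K * (B + C)"])
    show "0 \<le> K * (B + C)" using K B C by simp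
    fix u w assume uw: "u \<le> w" "{u..w} \<subseteq> {s..t}"
    then have uw': "u \<in> {s..t}" "w \<in> {s..t}" by auto
    have "prod (f w) (g w) - prod (f u) (g u) = prod (f w - f u) (g w) + prod (f u) (g w - g u)"
      by (simp add: diff_left diff_right)
    also have "norm \<dots> \<le> norm (f w - f u) * norm (g w) * K + norm (f u) * norm (g w - g u) * K"
      by (rule norm_triangle_le[OF add_mono[OF K(2) K(2)]])
    also have "\<dots> \<le> norm (f w - f u) * (B + C) * K + (B + C) * norm (g w - g u) * K"
      using K B(1) C(1) B(2)[OF uw'(1)] C(2)[OF uw'(2)]
      by (intro add_mono mult_right_mono mult_left_mono) auto
    finally show "norm (prod (f w) (g w) - prod (f u) (g u))
        \<le> K * (B + C) * (norm (f w - f u) + norm (g w - g u))"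
      by (simp add: algebra_simps)
  qed
qed

lemma absolutely_continuous_on_C1:
  fixes f :: "real \<Rightarrow> real"
  assumes deriv: "\<And>t. t \<in> {a..b} \<Longrightarrow> (f has_real_derivative f' t) (at t within {a..b})"
    and cont: "continuous_on {a..b} f'"
  shows "absolutely_continuous_on {a..b} f"
proof -
  have "bounded (f' ` {a..b})"
    using cont by (auto intro!: compact_imp_bounded compact_continuous_image)
  then obtain B where B: "B > 0" "\<And>x. x \<in> {a..b} \<Longrightarrow> norm (f' x) \<le> B"
    unfolding bounded_pos by blast
  have "B-lipschitz_on {a..b} f"
  proof (rule lipschitz_onI)
    fix u w assume "u \<in> {a..b}" "w \<in> {a..b}"
    then show "dist (f u) (f w) \<le> B * dist u w"
      using field_differentiable_bound[of "{a..b}" f f' B u w] deriv B by (auto simp: dist_norm)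
  qed (use B in auto)
  then show ?thesis by (rule absolutely_continuous_on_lipschitz)
qed

text \<open>The null set \<open>N\<close> of bad points has a neighbourhood \<open>U\<close> of small measure.  Choose a gauge that, at a point
outside \<open>N\<close>, is so fine that the increment of \<open>f\<close> over an interval around the tag is at most \<open>e\<close> times its
length, and that stays inside \<open>U\<close> at the points of \<open>N\<close>.  By Cousin's lemma there is a tagged division fine for
it.  Its intervals tagged outside \<open>N\<close> contribute at most \<open>e (b - a)\<close> to \<open>f b - f a\<close>; those tagged in \<open>N\<close> have
small total length and contribute at most \<open>e\<close> by absolute continuity.\<close>

lemma absolutely_continuous_nonincreasing:
  fixes f :: "real \<Rightarrow> real"
  assumes "a \<le> b" and ac: "absolutely_continuous_on {a..b} f"
    and deriv: "AE t in lborel. t \<in> {a..b} \<longrightarrow>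
      (\<exists>D\<le>0. (f has_real_derivative D) (at t within {a..b}))"
  shows "f b \<le> f a"
proof -
  have main: "f b - f a \<le> e * (b - a) + e" if e: "e > 0" for e :: real
  proof -
    obtain d where d: "d > 0" "\<And>D. finite D \<and> (\<forall>(u, w)\<in>D. u \<le> w \<and> {u..w} \<subseteq> {a..b}) \<and>
        disjoint_family_on (\<lambda>(u, w). {u<..<w}) D \<and> (\<Sum>(u, w)\<in>D. w - u) < d \<Longrightarrow>
        (\<Sum>(u, w)\<in>D. norm (f w - f u)) < e"
      using ac e unfolding absolutely_continuous_on_def by meson
    obtain N where N: "N \<in> sets lborel" "emeasure lborel N = 0"
      "\<And>t. t \<in> {a..b} - N \<Longrightarrow> \<exists>D\<le>0. (f has_real_derivative D) (at t within {a..b})"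
      using deriv by (elim AE_E) (auto simp: subset_iff, blast?)
    obtain U where U: "open U" "N \<subseteq> U" "emeasure lborel (U - N) < ennreal d"
      using outer_regular_lborel[of N d] N(1) d(1) by (metis sets_lborel)
    have "emeasure lborel U \<le> emeasure lborel (U - N) + emeasure lborel N"
      using emeasure_subadditive[of "U - N" lborel N] N(1) U(1,2) by (simp add: Un_absorb2)
    then have U_small: "emeasure lborel U < ennreal d" using U(3) N(2) by simp
    have "\<exists>G. open G \<and> t \<in> G \<and> (t \<in> N \<longrightarrow> G \<subseteq> U) \<and>
       (t \<in> {a..b} - N \<longrightarrow> (\<forall>u w. u \<le> t \<and> t \<le> w \<and> {u..w} \<subseteq> G \<inter> {a..b} \<longrightarrow> f w - f u \<le> e * (w - u)))"
      for t
    proof (cases "t \<in> {a..b} - N")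
      case True
      then obtain D where D: "D \<le> 0" "(f has_real_derivative D) (at t within {a..b})"
        using N(3) by blast
      then obtain r where r: "r > 0"
        "\<And>y. y \<in> {a..b} \<Longrightarrow> norm (y - t) < r \<Longrightarrow> norm (f y - f t - D * (y - t)) \<le> e * norm (y - t)"
        using e unfolding has_field_derivative_def has_derivative_within_alt by blast
      have "f w - f u \<le> e * (w - u)"
        if uw: "u \<le> t" "t \<le> w" "{u..w} \<subseteq> ball t r \<inter> {a..b}" for u w
      proof -
        have "u \<in> {u..w}" "w \<in> {u..w}" using uw by auto
        then have "u \<in> ball t r \<inter> {a..b}" "w \<in> ball t r \<inter> {a..b}" using uw(3) by blast+
        then have *: "norm (f u - f t - D * (u - t)) \<le> e * norm (u - t)"
          "norm (f w - f t - D * (w - t)) \<le> e * norm (w - t)"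
          using r(2)[of u] r(2)[of w] by (auto simp: dist_norm norm_minus_commute)
        have "D * (w - t) \<le> 0" "D * (u - t) \<ge> 0"
          using D(1) uw by (auto simp: mult_le_0_iff zero_le_mult_iff)
        moreover have "e * norm (u - t) = e * (t - u)" "e * norm (w - t) = e * (w - t)"
          using uw by auto
        moreover have "e * (w - u) = e * (t - u) + e * (w - t)"
          by (simp add: algebra_simps)
        ultimately show ?thesis using * unfolding real_norm_def by linarith
      qed
      then show ?thesis using True r(1) by (intro exI[of _ "ball t r"]) auto
    next
      case False
      then show ?thesis using U by (intro exI[of _ "if t \<in> N then U else UNIV"]) auto
    qed
    then obtain \<gamma> where \<gamma>: "\<And>t. open (\<gamma> t)" "\<And>t. t \<in> \<gamma> t" "\<And>t. t \<in> N \<Longrightarrow> \<gamma> t \<subseteq> U"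
      "\<And>t u w. t \<in> {a..b} - N \<Longrightarrow> u \<le> t \<Longrightarrow> t \<le> w \<Longrightarrow> {u..w} \<subseteq> \<gamma> t \<inter> {a..b}
         \<Longrightarrow> f w - f u \<le> e * (w - u)"
      by metis
    have "gauge \<gamma>" using \<gamma>(1,2) by (auto simp: gauge_def)
    then obtain p where p: "p tagged_division_of {a..b}" "\<gamma> fine p"
      by (rule fine_division_exists_real)
    define p1 where "p1 = {(t, K) \<in> p. t \<in> N}"
    have p1: "p1 \<subseteq> p" by (auto simp: p1_def)
    have fin: "finite p" using p(1) by blast
    have K: "u \<le> w \<and> t \<in> {u..w} \<and> {u..w} \<subseteq> \<gamma> t \<inter> {a..b} \<and> u = Inf K \<and> w = Sup K \<and> K = {u..w}"
      if "(t, K) \<in> p" "K = cbox u w" for t K u w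
      using tagged_division_ofD(2,3)[OF p(1) that(1)] fineD[OF p(2) that(1)] that(2) by auto
    have K': "\<exists>u w. u \<le> w \<and> t \<in> {u..w} \<and> {u..w} \<subseteq> \<gamma> t \<inter> {a..b} \<and> u = Inf K \<and> w = Sup K \<and> K = {u..w}"
      if "(t, K) \<in> p" for t K
      using tagged_division_ofD(4)[OF p(1) that] K[OF that] by blast
    have "(\<Sum>(t, K)\<in>p - p1. f (Sup K) - f (Inf K)) \<le> (\<Sum>(t, K)\<in>p - p1. e * (Sup K - Inf K))"
    proof (rule sum_mono, clarify)
      fix t K assume "(t, K) \<in> p" "(t, K) \<notin> p1"
      then show "f (Sup K) - f (Inf K) \<le> e * (Sup K - Inf K)"
        using K'[of t K] \<gamma>(4)[of t "Inf K" "Sup K"] by (fastforce simp: p1_def)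
    qed
    also have "\<dots> \<le> (\<Sum>(t, K)\<in>p. e * (Sup K - Inf K))"
      proof (rule sum_mono2[OF fin], goal_cases)
      case (2 q)
      then obtain t K where "q = (t, K)" "(t, K) \<in> p" by (cases q) auto
      then show ?case using K'[of t K] e by auto
    qed simp
    also have "\<dots> = e * (b - a)"
      using additive_tagged_division_1[OF \<open>a \<le> b\<close> p(1), of "\<lambda>x. e * x"]
      by (simp add: right_diff_distrib split_beta)
    finally have regular: "(\<Sum>(t, K)\<in>p - p1. f (Sup K) - f (Inf K)) \<le> e * (b - a)" .
    \<comment> \<open>The intervals with a tag in \<open>N\<close>, encoded as endpoint pairs so that absolute continuity applies.  Passing from tagged intervals
      to pairs identifies at most degenerate intervals, over which the increment vanishes.\<close>
    define S where "S = snd ` p1"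
    define D where "D = (\<lambda>K. (Inf K, Sup K)) ` S"
    have tp: "p1 tagged_partial_division_of {a..b}"
      using p(1) p1 unfolding tagged_division_of_def by (blast intro: tagged_partial_division_subset)
    note td = tagged_partial_division_of_Union_self[OF tp]
    have SK: "\<exists>u w. u \<le> w \<and> {u..w} \<subseteq> U \<inter> {a..b} \<and> u = Inf K \<and> w = Sup K \<and> K = {u..w}"
      if "K \<in> S" for K
      using that K' \<gamma>(3) unfolding S_def p1_def by fastforce
    have inj: "inj_on (\<lambda>K. (Inf K, Sup K)) S"
    proof (rule inj_onI)
      fix K L assume "K \<in> S" "L \<in> S" "(Inf K, Sup K) = (Inf L, Sup L)"
      then show "K = L" using SK[of K] SK[of L] by auto
    qed
    have finS: "finite S" using finite_subset[OF p1 fin] by (simp add: S_def)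
    have Dval: "u \<le> w \<and> {u..w} \<subseteq> U \<inter> {a..b} \<and> {u..w} \<in> S" if "(u, w) \<in> D" for u w
    proof -
      obtain K where K: "K \<in> S" "u = Inf K" "w = Sup K" using \<open>(u, w) \<in> D\<close> by (auto simp: D_def)
      then show ?thesis using SK[OF K(1)] K(1) by metis
    qed
    have disj: "disjoint_family_on (\<lambda>(u, w). {u<..<w}) D"
    proof -
      have "{u<..<w} \<inter> {u'<..<w'} = {}"
        if "(u, w) \<in> D" "(u', w') \<in> D" "(u, w) \<noteq> (u', w')" for u w u' w'
      proof -
        have "{u..w} \<noteq> {u'..w'}"
          using that Dval[OF that(1)] Dval[OF that(2)] by (auto simp: Icc_eq_Icc)
        then have "interior {u..w} \<inter> interior {u'..w'} = {}"
          using Dval[OF that(1)] Dval[OF that(2)] division_of_tagged_division[OF td]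
          unfolding S_def[symmetric] by (meson division_ofD(5))
        then show ?thesis by simp
      qed
      then have "(case q of (u, w) \<Rightarrow> {u<..<w}) \<inter> (case r of (u, w) \<Rightarrow> {u<..<w}) = {}"
        if "q \<in> D" "r \<in> D" "q \<noteq> r" for q r
        using that by (cases q; cases r) simp
      then show ?thesis unfolding disjoint_family_on_def by blast
    qed
    have finD: "finite D" using finS by (simp add: D_def)
    have "ennreal (\<Sum>(u, w)\<in>D. w - u) = (\<Sum>(u, w)\<in>D. ennreal (w - u))"
      using Dval by (subst sum_ennreal[symmetric]) (auto simp: split_beta)
    also have "\<dots> = (\<Sum>q\<in>D. emeasure lborel (case q of (u, w) \<Rightarrow> {u<..<w}))"
      using Dval by (intro sum.cong) auto
    also have "\<dots> = emeasure lborel (\<Union>q\<in>D. case q of (u, w) \<Rightarrow> {u<..<w})"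
      using finD disj by (intro sum_emeasure) auto
    also have "\<dots> \<le> emeasure lborel U"
      using Dval U(1) by (intro emeasure_mono) (fastforce+)
    also have "\<dots> < ennreal d" by (rule U_small)
    finally have small: "(\<Sum>(u, w)\<in>D. w - u) < d"
      by (subst (asm) ennreal_less_iff) (use Dval in \<open>auto intro!: sum_nonneg\<close>)
    have "(\<Sum>(t, K)\<in>p1. f (Sup K) - f (Inf K)) = (\<Sum>K\<in>S. f (Sup K) - f (Inf K))"
    proof -
      let ?d = "\<lambda>K. if interior K = {} then 0 else f (Sup K) - f (Inf K)"
      have deg: "?d K = f (Sup K) - f (Inf K)" if K: "K \<in> S" for K
      proof -
        obtain u w where uw: "u \<le> w" "K = {u..w}" using SK[OF K] by metis
        show ?thesis
        proof (cases "interior K = {}")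
          case True
          then have "u = w" using uw by simp
          then show ?thesis using uw by simp
        qed simp
      qed
      have "(\<Sum>(t, K)\<in>p1. f (Sup K) - f (Inf K)) = (\<Sum>(t, K)\<in>p1. ?d K)"
        using deg by (intro sum.cong refl) (force simp: S_def)
      also have "\<dots> = (\<Sum>K\<in>S. ?d K)"
        unfolding S_def by (rule sum.over_tagged_division_lemma[OF td]) simp
      also have "\<dots> = (\<Sum>K\<in>S. f (Sup K) - f (Inf K))"
        by (intro sum.cong refl deg)
      finally show ?thesis .
    qed
    also have "\<dots> = (\<Sum>(u, w)\<in>D. f w - f u)"
      unfolding D_def by (subst sum.reindex[OF inj]) (auto simp: o_def)
    also have "\<dots> \<le> (\<Sum>(u, w)\<in>D. norm (f w - f u))"
      by (intro sum_mono) auto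
    also have "\<dots> < e"
      using finD disj small Dval by (intro d(2)) auto
    finally have singular: "(\<Sum>(t, K)\<in>p1. f (Sup K) - f (Inf K)) < e" .
    have "f b - f a = (\<Sum>(t, K)\<in>p. f (Sup K) - f (Inf K))"
      using additive_tagged_division_1[OF \<open>a \<le> b\<close> p(1), of f] by simp
    also have "\<dots> = (\<Sum>(t, K)\<in>p - p1. f (Sup K) - f (Inf K)) + (\<Sum>(t, K)\<in>p1. f (Sup K) - f (Inf K))"
      by (rule sum.subset_diff[OF p1 fin])
    finally show ?thesis using regular singular by linarith
  qed
  have "f b - f a \<le> 0 + r" if "r > 0" for r :: real
  proof -
    have "r / (b - a + 1) > 0" using \<open>a \<le> b\<close> that by simp
    moreover have "r / (b - a + 1) * (b - a) + r / (b - a + 1) = r"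
    proof -
      have "r / (b - a + 1) * (b - a) + r / (b - a + 1) = r / (b - a + 1) * (b - a + 1)"
        by (simp add: distrib_left)
      then show ?thesis using \<open>a \<le> b\<close> by simp
    qed
    ultimately show ?thesis using main[of "r / (b - a + 1)"] by simp
  qed
  then have "f b - f a \<le> 0" by (rule field_le_epsilon)
  then show ?thesis by simp
qed

lemma absolutely_continuous_le_integral:
  fixes f h :: "real \<Rightarrow> real"
  assumes "a \<le> b" and ac: "absolutely_continuous_on {a..b} f" and h: "continuous_on {a..b} h"
    and deriv: "AE t in lborel. t \<in> {a..b} \<longrightarrow>
      (\<exists>D\<le>h t. (f has_real_derivative D) (at t within {a..b}))"
  shows "f b - f a \<le> integral {a..b} h"
proof -
  let ?I = "\<lambda>t. integral {a..t} h"
  have I: "(?I has_real_derivative h t) (at t within {a..b})" if "t \<in> {a..b}" for t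
    by (rule integral_has_real_derivative[OF h that])
  have "f b + (- ?I b) \<le> f a + (- ?I a)"
  proof (rule absolutely_continuous_nonincreasing[OF \<open>a \<le> b\<close>])
    show "absolutely_continuous_on {a..b} (\<lambda>t. f t + - ?I t)"
      using I h by (intro absolutely_continuous_on_add ac
          absolutely_continuous_on_C1[of _ _ _ "\<lambda>t. - h t"] continuous_intros derivative_intros) auto
    show "AE t in lborel. t \<in> {a..b} \<longrightarrow>
      (\<exists>D\<le>0. ((\<lambda>t. f t + - ?I t) has_real_derivative D) (at t within {a..b}))"
      using deriv
    proof eventually_elim
      case (elim t)
      show ?case
      proof
        assume t: "t \<in> {a..b}"
        then obtain D where D: "D \<le> h t" "(f has_real_derivative D) (at t within {a..b})"
          using elim by blast
        show "\<exists>D\<le>0. ((\<lambda>t. f t + - ?I t) has_real_derivative D) (at t within {a..b})"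
          using D by (intro exI[of _ "D + - h t"] conjI DERIV_add DERIV_minus I[OF t]) auto
      qed
    qed
  qed
  then show ?thesis by simp
qed

lemma continuous_on_Ici_if_ac:
  fixes f :: "real \<Rightarrow> 'a::real_normed_vector"
  assumes "\<And>s. absolutely_continuous_on {a..s} f"
  shows "continuous_on {a..} f"
proof -
  have "continuous (at t within {a..}) f" if "t \<in> {a..}" for t
  proof -
    have "continuous (at t within {a..t + 1}) f"
      using absolutely_continuous_on_imp_continuous_on[OF assms[of "t + 1"]] that
      by (auto simp: continuous_on_eq_continuous_within)
    moreover have "at t within {a..t + 1} = at t within {a..}"
      using that by (intro at_within_nhd[of _ "{..<t + 1}"]) auto
    ultimately show ?thesis by simp
  qed
  then show ?thesis by (simp add: continuous_on_eq_continuous_within)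
qed

section \<open>Integrals and limits at infinity\<close>

lemma set_integrable_Ici_if_bounded_integrals:
  fixes f :: "real \<Rightarrow> real"
  assumes cont: "continuous_on {a..} f" and nonneg: "\<And>t. t \<ge> a \<Longrightarrow> 0 \<le> f t"
    and bound: "\<And>t. t \<ge> a \<Longrightarrow> integral {a..t} f \<le> C"
  shows "set_integrable lborel {a..} f"
proof -
  define A where "A n = {a..a + real n}" for n
  have A: "(\<Union>n. A n) = {a..}"
  proof (intro equalityI subsetI)
    fix t assume "t \<in> {a..}"
    obtain n where "t - a \<le> real n" using real_arch_simple by blast
    with \<open>t \<in> {a..}\<close> show "t \<in> (\<Union>n. A n)" by (auto simp: A_def intro!: exI[of _ n])
  qed (auto simp: A_def)
  have cA: "continuous_on (A n) f" for n
    using cont by (rule continuous_on_subset) (auto simp: A_def)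
  have intA: "set_integrable lborel (A n) f" for n
    using cA unfolding A_def by (rule borel_integrable_atLeastAtMost')
  have val: "(LINT x:A n|lborel. f x) = integral (A n) f" for n
    by (rule set_borel_integral_eq_integral[OF intA])
  have "incseq (\<lambda>n. integral (A n) f)"
    using nonneg by (intro incseq_SucI integral_subset_le set_borel_integral_eq_integral(1)[OF intA])
      (auto simp: A_def)
  moreover have "\<And>n. integral (A n) f \<le> C" unfolding A_def by (rule bound) simp
  ultimately obtain l where "(\<lambda>n. integral (A n) f) \<longlonglongrightarrow> l"
    using incseq_convergent[of "\<lambda>n. integral (A n) f" C] by blast
  then have "(\<lambda>n. LINT x:A n|lborel. f x) \<longlonglongrightarrow> l" unfolding val .
  then have "set_integrable lborel (\<Union>n. A n) f"
    using intA nonneg by (intro pos_integrable_to_top[of A _ f l])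
      (auto simp: A_def mono_def)
  then show ?thesis by (simp add: A)
qed

lemma nonincreasing_convergent_at_top:
  fixes f :: "real \<Rightarrow> real"
  assumes mono: "\<And>s t. a \<le> s \<Longrightarrow> s \<le> t \<Longrightarrow> f t \<le> f s" and lower: "\<And>t. a \<le> t \<Longrightarrow> m \<le> f t"
  obtains l where "(f \<longlongrightarrow> l) at_top" "\<And>t. a \<le> t \<Longrightarrow> l \<le> f t"
proof -
  define l where "l = Inf (f ` {a..})"
  have bdd: "bdd_below (f ` {a..})" using lower by (intro bdd_belowI[of _ m]) auto
  have l: "l \<le> f t" if "a \<le> t" for t unfolding l_def using bdd that by (intro cInf_lower) auto
  have "(f \<longlongrightarrow> l) at_top"
  proof (rule decreasing_tendsto)
    show "eventually (\<lambda>t. l \<le> f t) at_top" using eventually_ge_at_top[of a] by eventually_elim (rule l)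
    fix y assume "l < y"
    then obtain s where s: "a \<le> s" "f s < y"
      using cInf_lessD[of "f ` {a..}" y] by (auto simp: l_def)
    show "eventually (\<lambda>t. f t < y) at_top"
      using eventually_ge_at_top[of s] by eventually_elim (rule le_less_trans[OF mono[OF s(1)] s(2)])
  qed
  then show ?thesis using that l by blast
qed

text \<open>If \<open>E\<close> stayed above a positive constant \<open>r / 2\<close> from some \<open>T\<close> on, then \<open>m t \<ge> r / (2 t)\<close>, and the
integral of \<open>m\<close> would grow like a logarithm.  So \<open>E\<close> falls below \<open>r / 2\<close> at arbitrarily late times, and after such
a time it can regain at most the remaining integral of \<open>k\<close>, which is small as well.\<close>

lemma tendsto_zero_of_almost_nonincreasing:
  fixes E k m :: "real \<Rightarrow> real"
  assumes a: "a > 0" and nonneg: "\<And>t. a \<le> t \<Longrightarrow> 0 \<le> E t"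
    and k: "continuous_on {a..} k" "\<And>t. a \<le> t \<Longrightarrow> 0 \<le> k t" "\<And>t. a \<le> t \<Longrightarrow> integral {a..t} k \<le> K"
    and growth: "\<And>s t. a \<le> s \<Longrightarrow> s \<le> t \<Longrightarrow> E t - E s \<le> integral {s..t} k"
    and m: "continuous_on {a..} m" "\<And>t. a \<le> t \<Longrightarrow> 0 \<le> m t" "\<And>t. a \<le> t \<Longrightarrow> integral {a..t} m \<le> M"
    and rate: "\<And>t. a \<le> t \<Longrightarrow> E t \<le> t * m t"
  shows "(E \<longlongrightarrow> 0) at_top"
proof -
  have int: "f integrable_on {s..t}" if "continuous_on {a..} f" "a \<le> s" for f :: "real \<Rightarrow> real" and s t
    using that(2) by (intro integrable_continuous_real continuous_on_subset[OF that(1)]) auto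
  have split: "integral {a..t} f = integral {a..s} f + integral {s..t} f"
    if "continuous_on {a..} f" "a \<le> s" "s \<le> t" for f :: "real \<Rightarrow> real" and s t
    using that by (intro Henstock_Kurzweil_Integration.integral_combine[symmetric] int[OF that(1)]) auto
  have pos: "0 \<le> integral {s..t} f"
    if "continuous_on {a..} f" "a \<le> s" "\<And>t. a \<le> t \<Longrightarrow> 0 \<le> f t" for f :: "real \<Rightarrow> real" and s t
    using that(2,3) by (intro integral_nonneg int[OF that(1)]) auto
  obtain l where l: "((\<lambda>t. - integral {a..t} k) \<longlongrightarrow> l) at_top" "\<And>t. a \<le> t \<Longrightarrow> l \<le> - integral {a..t} k"
  proof (rule nonincreasing_convergent_at_top[of a "\<lambda>t. - integral {a..t} k" "- K"])
    fix s t assume st: "a \<le> s" "s \<le> t"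
    show "- integral {a..t} k \<le> - integral {a..s} k"
      using split[OF k(1) st] pos[OF k(1) st(1) k(2)] by simp
  qed (use k(3) in auto)
  show ?thesis
  proof (rule order_tendstoI)
    fix y :: real assume "y < 0"
    show "eventually (\<lambda>t. y < E t) at_top"
      using eventually_ge_at_top[of a] by eventually_elim (rule less_le_trans[OF \<open>y < 0\<close> nonneg])
  next
    fix r :: real assume r: "0 < r"
    have "eventually (\<lambda>t. - integral {a..t} k < l + r / 2) at_top"
      using l(1) by (rule order_tendstoD) (use r in simp)
    with eventually_ge_at_top[of a] have "eventually (\<lambda>t. a \<le> t \<and> - integral {a..t} k < l + r / 2) at_top"
      by (rule eventually_conj)
    then obtain T where T: "a \<le> T" "- integral {a..T} k < l + r / 2"
      using eventually_happens by fastforce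
    have "\<exists>s\<ge>T. E s < r / 2"
    proof (rule ccontr)
      assume "\<not> (\<exists>s\<ge>T. E s < r / 2)"
      then have big: "r / 2 \<le> E s" if "T \<le> s" for s using that by force
      \<comment> \<open>The point up to which \<open>r / (2 t)\<close>, integrated from \<open>T\<close>, yields \<open>M + 1\<close>.\<close>
      define c where "c = T * exp (2 * (M + 1) / r)"
      have M: "0 \<le> M" using m(3)[of a] by simp
      have T0: "T > 0" using T a by simp
      have "T * 1 \<le> c" unfolding c_def using T0 M r by (intro mult_left_mono) auto
      then have c: "T \<le> c" by simp
      have "((\<lambda>t. (r / 2) * (1 / t)) has_integral (r / 2 * ln c - r / 2 * ln T)) {T..c}"
      proof (rule fundamental_theorem_of_calculus[OF c])
        fix t assume "t \<in> {T..c}"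
        then have "((\<lambda>t. r / 2 * ln t) has_real_derivative r / 2 * (1 / t)) (at t within {T..c})"
          using T0 by (intro DERIV_cmult DERIV_ln_divide[THEN DERIV_subset]) auto
        then show "((\<lambda>t. r / 2 * ln t) has_vector_derivative r / 2 * (1 / t)) (at t within {T..c})"
          by (simp add: has_real_derivative_iff_has_vector_derivative)
      qed
      then have "r / 2 * ln c - r / 2 * ln T \<le> integral {T..c} m"
      proof (rule has_integral_le)
        show "(m has_integral integral {T..c} m) {T..c}"
          using int[OF m(1) T(1)] by (rule integrable_integral)
        fix t assume t: "t \<in> {T..c}"
        then have "r / 2 \<le> t * m t" using big[of t] rate[of t] T by simp
        then show "r / 2 * (1 / t) \<le> m t" using t T0 by (simp add: field_simps)
      qed
      also have "\<dots> \<le> integral {a..c} m"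
        using split[OF m(1) T(1) c] pos[OF m(1) _ m(2), of a T] by simp
      also have "\<dots> \<le> M" using m(3) T c by simp
      finally have "r / 2 * (ln c - ln T) \<le> M" by (simp add: right_diff_distrib)
      moreover have "ln c - ln T = 2 * (M + 1) / r"
        unfolding c_def using T0 by (simp add: ln_mult)
      ultimately show False using r by simp
    qed
    then obtain s where s: "T \<le> s" "E s < r / 2" by blast
    show "eventually (\<lambda>t. E t < r) at_top"
      using eventually_ge_at_top[of s]
    proof eventually_elim
      case (elim t)
      have "E t - E s \<le> integral {s..t} k" using growth T(1) s(1) elim by simp
      moreover have "integral {a..t} k = integral {a..T} k + integral {T..s} k + integral {s..t} k"
        using split[OF k(1), of s t] split[OF k(1), of T s] T(1) s(1) elim by simp
      moreover have "0 \<le> integral {T..s} k" using pos[OF k(1) T(1) k(2)] .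
      moreover have "l \<le> - integral {a..t} k" using l(2)[of t] T(1) s(1) elim by simp
      ultimately show ?case using T(2) s(2) by simp
    qed
  qed
qed

section \<open>Weak convergence in Hilbert spaces\<close>

text \<open>The representing vector minimises the quadratic functional \<open>J y = \<parallel>y\<parallel>\<^sup>2 - 2 f y\<close>: the parallelogram law makes
every minimising sequence a Cauchy sequence, and the first-order condition at the minimum says that
\<open>f y = \<langle>z, y\<rangle>\<close>.\<close>

lemma riesz_representation_real:
  fixes f :: "'a::{real_inner, complete_space} \<Rightarrow> real"
  assumes lin: "linear f" and bound: "\<And>y. \<bar>f y\<bar> \<le> M * norm y"
  obtains z where "\<And>y. f y = z \<bullet> y"
proof -
  interpret linear f by (rule lin)
  define J where "J y = y \<bullet> y - 2 * f y" for y
  have J_lower: "- M\<^sup>2 \<le> J y" for y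
  proof -
    have "2 * f y \<le> 2 * M * norm y" using bound[of y] by simp
    also have "\<dots> \<le> M\<^sup>2 + (norm y)\<^sup>2" using sum_squares_bound[of M "norm y"] by simp
    finally show ?thesis by (simp add: J_def power2_norm_eq_inner)
  qed
  define m where "m = Inf (range J)"
  have bdd: "bdd_below (range J)" using J_lower by (intro bdd_belowI[of _ "- M\<^sup>2"]) auto
  have m_le: "m \<le> J y" for y unfolding m_def using bdd by (intro cInf_lower) auto
  have "\<exists>y. J y < m + 1 / real (Suc n)" for n
    using cInf_lessD[of "range J" "m + 1 / real (Suc n)"] by (auto simp: m_def)
  then obtain s where s: "\<And>n. J (s n) < m + 1 / real (Suc n)" by metis
  have near: "(norm (y - w))\<^sup>2 \<le> 2 * (J y - m) + 2 * (J w - m)" for y w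
  proof -
    have "(norm (y - w))\<^sup>2 = 2 * J y + 2 * J w - 4 * J ((1/2) *\<^sub>R (y + w))"
      unfolding J_def power2_norm_eq_inner scale add
      by (simp add: inner_simps inner_commute algebra_simps)
    then show ?thesis using m_le[of "(1/2) *\<^sub>R (y + w)"] by simp
  qed
  have "Cauchy s"
    unfolding Cauchy_altdef2
  proof (intro allI impI)
    fix e :: real assume "e > 0"
    then obtain n where n: "1 / real (Suc n) < e\<^sup>2 / 4"
      by (metis nat_approx_posE zero_less_divide_iff zero_less_numeral zero_less_power)
    have "dist (s k) (s n) < e" if "k \<ge> n" for k
    proof -
      have "1 / real (Suc k) \<le> 1 / real (Suc n)" using that by (simp add: frac_le)
      then have "(norm (s k - s n))\<^sup>2 < e\<^sup>2"
        using near[of "s k" "s n"] s[of k] s[of n] n by simp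
      then show ?thesis
        using \<open>e > 0\<close> by (simp add: dist_norm power_less_imp_less_base)
    qed
    then show "\<exists>N. \<forall>n\<ge>N. dist (s n) (s N) < e" by blast
  qed
  then obtain z where z: "s \<longlonglongrightarrow> z" using Cauchy_convergent convergent_def by blast
  have "bounded_linear f"
    using bound by (intro bounded_linear_intro[where K = M]) (auto simp: add scale mult.commute)
  then have "(\<lambda>n. f (s n)) \<longlonglongrightarrow> f z" using z by (rule bounded_linear.tendsto)
  then have "(\<lambda>n. J (s n)) \<longlonglongrightarrow> J z"
    unfolding J_def by (intro tendsto_diff tendsto_mult tendsto_inner tendsto_const z)
  moreover have "(\<lambda>n. m + 1 / real (Suc n)) \<longlonglongrightarrow> m + 0"
    by (intro tendsto_add tendsto_const LIMSEQ_Suc[OF lim_1_over_n])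
  ultimately have Jz: "J z \<le> m"
    using s by (intro LIMSEQ_le[of "\<lambda>n. J (s n)" _ "\<lambda>n. m + 1 / real (Suc n)"]) (auto intro!: exI[of _ 0] less_imp_le)
  have half: "0 \<le> z \<bullet> y - f y" for y
  proof (rule ccontr)
    assume neg: "\<not> 0 \<le> z \<bullet> y - f y"
    define c where "c = f y - z \<bullet> y"
    have c: "c > 0" using neg by (simp add: c_def)
    have J: "J (z + r *\<^sub>R y) = J z - 2 * r * c + r\<^sup>2 * (y \<bullet> y)" for r
      unfolding J_def c_def add scale
      by (simp add: inner_simps inner_commute algebra_simps power2_eq_square)
    \<comment> \<open>A step length for which the linear decrease \<open>2 r c\<close> outweighs the quadratic term.\<close>
    define r where "r = c / (y \<bullet> y + 1)"
    have yy: "y \<bullet> y + 1 > 0" by (smt (verit) inner_ge_zero)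
    then have r: "r > 0" using c by (simp add: r_def)
    have "r * (y \<bullet> y + 1) = c" using yy by (simp add: r_def)
    then have "r * (y \<bullet> y) < c" using r by (simp add: distrib_left)
    then have "r * (r * (y \<bullet> y)) < r * c" using r by simp
    moreover have "r * c > 0" using r c by simp
    ultimately show False
      using J[of r] m_le[of "z + r *\<^sub>R y"] Jz by (simp add: power2_eq_square mult.assoc)
  qed
  have "f y = z \<bullet> y" for y
    using half[of y] half[of "- y"] by (simp add: neg)
  then show ?thesis by (rule that)
qed

text \<open>A weak form of the Banach-Alaoglu theorem.  The functionals \<open>y \<mapsto> \<langle>x t, y\<rangle>\<close> lie in a product of compact
intervals, which is compact by Tychonoff's theorem, so they have a pointwise cluster point \<open>\<phi>\<close>.  It is linear and
bounded, hence represented by a vector.  A finer filter takes the place of a subsequence.\<close>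

lemma weak_cluster_point:
  fixes x :: "'b \<Rightarrow> 'a::{real_inner, complete_space}"
  assumes F: "F \<noteq> bot" and bound: "eventually (\<lambda>t. norm (x t) \<le> M) F"
  obtains z G where "G \<le> F" "G \<noteq> bot" "weakly_tendsto x z G"
proof -
  define X where "X t = (\<lambda>y. x t \<bullet> y)" for t
  define K where "K = Pi\<^sub>E (UNIV :: 'a set) (\<lambda>y. {- (M * norm y)..M * norm y})"
  have "compact K"
    using compactin_PiE[of "\<lambda>_. euclidean" UNIV "\<lambda>y::'a. {- (M * norm y)..M * norm y}"]
    by (simp add: euclidean_product_topology K_def)
  moreover have "filtermap X F \<noteq> bot" using F by (simp add: filtermap_bot_iff)
  moreover have "eventually (\<lambda>\<phi>. \<phi> \<in> K) (filtermap X F)"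
    unfolding eventually_filtermap using bound
  proof eventually_elim
    case (elim t)
    have "\<bar>x t \<bullet> y\<bar> \<le> M * norm y" for y
      using Cauchy_Schwarz_ineq2[of "x t" y] elim by (meson mult_right_mono norm_ge_zero order_trans)
    then show ?case by (auto simp: K_def X_def PiE_iff abs_le_iff minus_le_iff)
  qed
  ultimately obtain \<phi> where \<phi>: "\<phi> \<in> K" "inf (nhds \<phi>) (filtermap X F) \<noteq> bot"
    unfolding compact_filter by blast
  define G where "G = inf F (filtercomap X (nhds \<phi>))"
  have GF: "G \<le> F" unfolding G_def by simp
  have "G \<noteq> bot"
  proof
    assume "G = bot"
    then have "eventually (\<lambda>_. False) G" by simp
    then obtain A B where AB: "eventually A F" "eventually B (nhds \<phi>)" "\<And>t. A t \<Longrightarrow> B (X t) \<Longrightarrow> False"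
      unfolding G_def eventually_inf eventually_filtercomap by blast
    have "eventually (\<lambda>\<psi>. \<not> B \<psi>) (filtermap X F)"
      unfolding eventually_filtermap using AB(1) by eventually_elim (use AB(3) in blast)
    then have "eventually (\<lambda>_. False) (inf (nhds \<phi>) (filtermap X F))"
      unfolding eventually_inf using AB(2) by blast
    then show False using \<phi>(2) by (simp add: trivial_limit_def)
  qed
  have "filterlim X (nhds \<phi>) G"
    unfolding G_def filterlim_iff_le_filtercomap by simp
  then have lim: "((\<lambda>t. x t \<bullet> y) \<longlongrightarrow> \<phi> y) G" for y
    using continuous_on_tendsto_compose[OF continuous_on_product_coordinates[of y], of X \<phi> G]
    by (simp add: X_def)
  have "linear \<phi>"
  proof (rule linearI)
    fix y y' :: 'a and c :: real
    have "((\<lambda>t. x t \<bullet> (y + y')) \<longlongrightarrow> \<phi> y + \<phi> y') G"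
      unfolding inner_add_right by (intro tendsto_add lim)
    then show "\<phi> (y + y') = \<phi> y + \<phi> y'"
      using lim[of "y + y'"] \<open>G \<noteq> bot\<close> tendsto_unique by blast
    have "((\<lambda>t. x t \<bullet> (c *\<^sub>R y)) \<longlongrightarrow> c * \<phi> y) G"
      unfolding inner_scaleR_right by (intro tendsto_mult tendsto_const lim)
    then show "\<phi> (c *\<^sub>R y) = c *\<^sub>R \<phi> y"
      using lim[of "c *\<^sub>R y"] \<open>G \<noteq> bot\<close> tendsto_unique by (auto simp del: inner_scaleR_right)
  qed
  moreover have "\<bar>\<phi> y\<bar> \<le> M * norm y" for y
    using \<phi>(1) by (auto simp: K_def PiE_iff abs_le_iff minus_le_iff)
  ultimately obtain z where "\<And>y. \<phi> y = z \<bullet> y" using riesz_representation_real[of \<phi> M] by blast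
  then have "weakly_tendsto x z G" using lim by (simp add: weakly_tendsto_def)
  then show ?thesis using that GF \<open>G \<noteq> bot\<close> by blast
qed

text \<open>Opial's lemma.  For two cluster points \<open>z\<close> and \<open>z'\<close> in \<open>C\<close>, the inner product \<open>\<langle>x t, z' - z\<rangle>\<close> is an affine
function of the difference of the squared distances to \<open>z\<close> and to \<open>z'\<close>, so it converges.  Its limit along the two
filters is \<open>\<langle>z, z' - z\<rangle>\<close> and \<open>\<langle>z', z' - z\<rangle>\<close>, whence \<open>z = z'\<close>.  A bounded trajectory with a single weak cluster
point converges weakly.\<close>

lemma opial:
  fixes x :: "'b \<Rightarrow> 'a::{real_inner, complete_space}"
  assumes F: "F \<noteq> bot" and "C \<noteq> {}"
    and dist: "\<And>z. z \<in> C \<Longrightarrow> \<exists>l. ((\<lambda>t. (norm (x t - z))\<^sup>2) \<longlongrightarrow> l) F"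
    and cluster: "\<And>z G. G \<le> F \<Longrightarrow> G \<noteq> bot \<Longrightarrow> weakly_tendsto x z G \<Longrightarrow> z \<in> C"
  shows "\<exists>z\<in>C. weakly_tendsto x z F"
proof -
  obtain c where "c \<in> C" using \<open>C \<noteq> {}\<close> by blast
  then obtain l where "((\<lambda>t. (norm (x t - c))\<^sup>2) \<longlongrightarrow> l) F" using dist by blast
  then have "eventually (\<lambda>t. (norm (x t - c))\<^sup>2 < l + 1) F"
    by (rule order_tendstoD) simp
  then have bound: "eventually (\<lambda>t. norm (x t) \<le> norm c + (l + 2)) F"
  proof eventually_elim
    case (elim t)
    have "norm (x t - c) \<le> (norm (x t - c))\<^sup>2 + 1"
      using sum_squares_bound[of "norm (x t - c)" 1, simplified] norm_ge_zero[of "x t - c"] by linarith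
    then show ?case using elim norm_triangle_sub[of "x t" c] by simp
  qed
  obtain z G where G: "G \<le> F" "G \<noteq> bot" "weakly_tendsto x z G"
    using weak_cluster_point[OF F bound] by blast
  have z: "z \<in> C" by (rule cluster[OF G])
  have unique: "z' = z" if G': "G' \<le> F" "G' \<noteq> bot" "weakly_tendsto x z' G'" for z' G'
  proof -
    have z': "z' \<in> C" by (rule cluster[OF G'])
    obtain l1 l2 where l: "((\<lambda>t. (norm (x t - z))\<^sup>2) \<longlongrightarrow> l1) F" "((\<lambda>t. (norm (x t - z'))\<^sup>2) \<longlongrightarrow> l2) F"
      using dist z z' by meson
    have *: "x t \<bullet> (z' - z) = ((norm (x t - z))\<^sup>2 - (norm (x t - z'))\<^sup>2 - z \<bullet> z + z' \<bullet> z') / 2" for t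
      by (simp add: power2_norm_eq_inner inner_simps inner_commute)
    define m where "m = (l1 - l2 - z \<bullet> z + z' \<bullet> z') / 2"
    have m: "((\<lambda>t. x t \<bullet> (z' - z)) \<longlongrightarrow> m) F"
      unfolding * m_def by (intro tendsto_divide tendsto_add tendsto_diff tendsto_const l) simp
    have "z \<bullet> (z' - z) = m"
      using tendsto_unique[OF G(2)] G(3) tendsto_mono[OF G(1) m] unfolding weakly_tendsto_def by blast
    moreover have "z' \<bullet> (z' - z) = m"
      using tendsto_unique[OF G'(2)] G'(3) tendsto_mono[OF G'(1) m] unfolding weakly_tendsto_def by blast
    ultimately have "(z' - z) \<bullet> (z' - z) = 0" by (simp add: inner_diff_left)
    then show ?thesis by simp
  qed
  have "weakly_tendsto x z F"
    unfolding weakly_tendsto_def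
  proof (intro allI tendstoI, rule ccontr)
    fix y and e :: real
    assume "e > 0" and "\<not> eventually (\<lambda>t. dist (x t \<bullet> y) (z \<bullet> y) < e) F"
    define F' where "F' = inf F (principal {t. e \<le> dist (x t \<bullet> y) (z \<bullet> y)})"
    have "F' \<noteq> bot"
      using \<open>\<not> eventually _ F\<close> unfolding F'_def trivial_limit_def eventually_inf_principal
      by (simp add: not_le)
    moreover have F'F: "F' \<le> F" unfolding F'_def by simp
    ultimately obtain z' G' where G': "G' \<le> F'" "G' \<noteq> bot" "weakly_tendsto x z' G'"
      using weak_cluster_point[OF _ filter_leD[OF F'F bound]] by blast
    have "z' = z" using unique[OF order_trans[OF G'(1) F'F] G'(2,3)] .
    then have "((\<lambda>t. x t \<bullet> y) \<longlongrightarrow> z \<bullet> y) G'" using G'(3) by (simp add: weakly_tendsto_def)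
    then have "eventually (\<lambda>t. dist (x t \<bullet> y) (z \<bullet> y) < e) G'" using \<open>e > 0\<close> by (rule tendstoD)
    moreover have "eventually (\<lambda>t. e \<le> dist (x t \<bullet> y) (z \<bullet> y)) G'"
      using filter_leD[OF G'(1)] by (auto simp: F'_def eventually_inf_principal)
    ultimately have "eventually (\<lambda>_. False) G'" by eventually_elim simp
    then show False using G'(2) by (simp add: trivial_limit_def)
  qed
  then show ?thesis using z by blast
qed

section \<open>Monotone operators\<close>

lemma tendsto_inner_bounded_zero:
  fixes f h :: "'b \<Rightarrow> 'a::real_inner"
  assumes "(h \<longlongrightarrow> 0) F" "eventually (\<lambda>t. norm (f t) \<le> B) F"
  shows "((\<lambda>t. f t \<bullet> h t) \<longlongrightarrow> 0) F"
proof (rule tendsto_0_le[OF assms(1), of _ B])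
  show "eventually (\<lambda>t. norm (f t \<bullet> h t) \<le> norm (h t) * B) F"
    using assms(2)
  proof eventually_elim
    case (elim t)
    have "norm (f t \<bullet> h t) \<le> norm (f t) * norm (h t)" by (rule Cauchy_Schwarz_ineq2[folded real_norm_def])
    also have "\<dots> \<le> B * norm (h t)" using elim by (rule mult_right_mono) simp
    finally show ?case by (simp add: mult.commute)
  qed
qed

text \<open>Minty's argument: passing to the limit in the monotonicity inequality gives \<open>\<langle>Q y, y - z\<rangle> \<ge> 0\<close> for all \<open>y\<close>, and
\<open>y = z - s Q z\<close> with \<open>s\<close> tending to \<open>0\<close> from above leads to \<open>- \<parallel>Q z\<parallel>\<^sup>2 \<ge> 0\<close>.\<close>

lemma monotone_operator_demiclosed_zero:
  fixes Q :: "'a::real_inner \<Rightarrow> 'a"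
  assumes mono: "monotone_operator Q" and cont: "continuous_on UNIV Q" and G: "G \<noteq> bot"
    and weak: "weakly_tendsto x z G" and bound: "eventually (\<lambda>t. norm (x t) \<le> M) G"
    and Q0: "((\<lambda>t. Q (x t)) \<longlongrightarrow> 0) G"
  shows "z \<in> zer Q"
proof -
  have minty: "0 \<le> Q y \<bullet> (y - z)" for y
  proof (rule tendsto_lowerbound[OF _ _ G])
    have "((\<lambda>t. Q (x t) \<bullet> (y - x t)) \<longlongrightarrow> 0) G"
    proof -
      have "eventually (\<lambda>t. norm (y - x t) \<le> norm y + M) G"
        using bound
      proof eventually_elim
        case (elim t)
        then show ?case using norm_triangle_ineq4[of y "x t"] by linarith
      qed
      from tendsto_inner_bounded_zero[OF Q0 this] show ?thesis by (simp only: inner_commute)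
    qed
    moreover have "((\<lambda>t. x t \<bullet> Q y) \<longlongrightarrow> z \<bullet> Q y) G" using weak by (simp add: weakly_tendsto_def)
    ultimately have "((\<lambda>t. Q y \<bullet> y - x t \<bullet> Q y - Q (x t) \<bullet> (y - x t)) \<longlongrightarrow> Q y \<bullet> y - z \<bullet> Q y - 0) G"
      by (intro tendsto_diff tendsto_const)
    moreover have "Q y \<bullet> y - x t \<bullet> Q y - Q (x t) \<bullet> (y - x t) = (Q y - Q (x t)) \<bullet> (y - x t)" for t
      by (simp add: inner_simps inner_commute)
    ultimately show "((\<lambda>t. (Q y - Q (x t)) \<bullet> (y - x t)) \<longlongrightarrow> Q y \<bullet> (y - z)) G"
      by (simp add: inner_simps inner_commute)
    show "eventually (\<lambda>t. 0 \<le> (Q y - Q (x t)) \<bullet> (y - x t)) G"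
      using mono by (simp add: monotone_operator_def)
  qed
  have "0 \<le> Q z \<bullet> (- Q z)"
  proof (rule tendsto_lowerbound)
    have "((\<lambda>s. z - s *\<^sub>R Q z) \<longlongrightarrow> z - 0 *\<^sub>R Q z) (at_right (0::real))"
      by (intro tendsto_intros)
    then have "((\<lambda>s. Q (z - s *\<^sub>R Q z)) \<longlongrightarrow> Q z) (at_right (0::real))"
      using cont by (intro continuous_on_tendsto_compose[of UNIV Q]) auto
    then show "((\<lambda>s. Q (z - s *\<^sub>R Q z) \<bullet> (- Q z)) \<longlongrightarrow> Q z \<bullet> (- Q z)) (at_right (0::real))"
      by (intro tendsto_intros)
    show "eventually (\<lambda>s::real. 0 \<le> Q (z - s *\<^sub>R Q z) \<bullet> (- Q z)) (at_right 0)"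
      using eventually_at_right_less[of "0::real"]
    proof eventually_elim
      case (elim s)
      have "0 \<le> s * (Q (z - s *\<^sub>R Q z) \<bullet> (- Q z))"
        using minty[of "z - s *\<^sub>R Q z"] by simp
      then show ?case using elim by (simp add: zero_le_mult_iff mult_le_0_iff)
    qed
  qed simp
  then have "Q z \<bullet> Q z = 0" using inner_ge_zero[of "Q z"] by (simp del: inner_ge_zero inner_eq_zero_iff)
  then show ?thesis by (simp add: zer_def)
qed

lemma has_vector_derivative_imp_quotient_tendsto:
  assumes "(f has_vector_derivative f') (at t within S)"
  shows "((\<lambda>y. (1 / (y - t)) *\<^sub>R (f y - f t)) \<longlongrightarrow> f') (at t within S)"
proof -
  have "((\<lambda>y. norm (f y - f t - (y - t) *\<^sub>R f') / norm (y - t)) \<longlongrightarrow> 0) (at t within S)"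
    using assms unfolding has_vector_derivative_def has_derivative_iff_norm by simp
  moreover have "eventually (\<lambda>y. norm (f y - f t - (y - t) *\<^sub>R f') / norm (y - t)
      = norm ((1 / (y - t)) *\<^sub>R (f y - f t) - f')) (at t within S)"
    unfolding eventually_at_filter
  proof (intro always_eventually allI impI)
    fix y assume "y \<noteq> t"
    then have "(1 / (y - t)) *\<^sub>R (f y - f t) - f' = (1 / (y - t)) *\<^sub>R (f y - f t - (y - t) *\<^sub>R f')"
      by (simp add: scaleR_diff_right)
    then show "norm (f y - f t - (y - t) *\<^sub>R f') / norm (y - t) = norm ((1 / (y - t)) *\<^sub>R (f y - f t) - f')"
      by simp
  qed
  ultimately have "((\<lambda>y. norm ((1 / (y - t)) *\<^sub>R (f y - f t) - f')) \<longlongrightarrow> 0) (at t within S)"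
    by (rule Lim_transform_eventually)
  then show ?thesis unfolding tendsto_norm_zero_iff by (rule LIM_zero_cancel)
qed

text \<open>The derivatives are limits of difference quotients, whose inner product is a nonnegative multiple of
\<open>\<langle>Q (x y) - Q (x t), x y - x t\<rangle>\<close>.\<close>

lemma monotone_operator_derivative_nonneg:
  fixes Q :: "'a::real_inner \<Rightarrow> 'a"
  assumes mono: "monotone_operator Q"
    and x: "(x has_vector_derivative v) (at t within S)"
    and q: "((\<lambda>s. Q (x s)) has_vector_derivative q) (at t within S)"
    and lim: "at t within S \<noteq> bot"
  shows "0 \<le> v \<bullet> q"
proof (rule tendsto_lowerbound[OF _ _ lim])
  show "((\<lambda>y. ((1 / (y - t)) *\<^sub>R (x y - x t)) \<bullet> ((1 / (y - t)) *\<^sub>R (Q (x y) - Q (x t)))) \<longlongrightarrow> v \<bullet> q)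
      (at t within S)"
    by (intro tendsto_inner has_vector_derivative_imp_quotient_tendsto x q)
  have "0 \<le> ((1 / (y - t)) *\<^sub>R (x y - x t)) \<bullet> ((1 / (y - t)) *\<^sub>R (Q (x y) - Q (x t)))" for y
  proof -
    have "0 \<le> (1 / (y - t))\<^sup>2 * ((Q (x y) - Q (x t)) \<bullet> (x y - x t))"
      using mono by (auto simp: monotone_operator_def)
    then show ?thesis by (simp add: power2_eq_square inner_commute mult.assoc)
  qed
  then show "eventually (\<lambda>y. 0 \<le> ((1 / (y - t)) *\<^sub>R (x y - x t)) \<bullet> ((1 / (y - t)) *\<^sub>R (Q (x y) - Q (x t))))
      (at t within S)" by simp
qed

section \<open>The energy of a trajectory\<close>

locale fast_ogda =
  fixes Q :: "'a::{real_inner, complete_space} \<Rightarrow> 'a"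
    and t0 \<alpha> \<eta> \<theta> \<epsilon> :: real
    and \<beta> \<beta>' b :: "real \<Rightarrow> real"
    and x v :: "real \<Rightarrow> 'a"
  assumes Q_mono: "monotone_operator Q"
    and Q_lipschitz: "\<exists>L. L-lipschitz_on UNIV Q"
    and t0: "t0 > 0"
    and \<alpha>: "\<alpha> \<ge> 2"
    and \<eta>: "\<eta> \<in> {0<..<1}"
    and \<theta>: "\<theta> = (1 - \<eta>) + \<eta> * (\<alpha> - 1)"
    and \<beta>_pos: "\<forall>t\<ge>t0. \<beta> t > 0"
    and \<beta>_deriv: "\<forall>t\<ge>t0. (\<beta> has_real_derivative \<beta>' t) (at t within {t0..})"
    and \<beta>'_cont: "continuous_on {t0..} \<beta>'"
    and b: "\<forall>t\<ge>t0. b t = (1 - \<eta>) * \<beta>' t + \<theta> * (\<beta> t / t)"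
    and sol: "strong_solution t0 \<alpha> \<beta> b Q x v"
    and \<epsilon>: "\<epsilon> \<in> {0..\<alpha> - 2}"
    and growth: "\<forall>t\<ge>t0. 0 \<le> \<beta>' t * t / \<beta> t \<and> \<beta>' t * t / \<beta> t \<le> \<alpha> - 2 - \<epsilon>"
begin

definition u :: "real \<Rightarrow> 'a" where "u t = Q (x t)"

text \<open>The rescaled residual, whose boundedness and convergence to zero are the rates for \<open>Q (x t)\<close>.\<close>

definition g :: "real \<Rightarrow> 'a" where "g t = (t * \<beta> t) *\<^sub>R u t"

text \<open>The weight \<open>1 - \<eta>\<close> of \<open>g\<close> is the one for which the terms with \<open>t \<beta>' \<langle>x', u\<rangle>\<close> cancel in the derivative
of the energy.\<close>

definition anchor :: "real \<Rightarrow> 'a \<Rightarrow> real \<Rightarrow> 'a" where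
  "anchor \<kappa> z t = \<kappa> *\<^sub>R (x t - z) + t *\<^sub>R v t + (1 - \<eta>) *\<^sub>R g t"

text \<open>With \<open>p = x - z\<close>, the derivative of the square contains multiples of \<open>\<langle>p, x'\<rangle>\<close>, \<open>\<langle>p, g'\<rangle>\<close> and \<open>\<langle>g, g'\<rangle>\<close>,
which have no sign; each of the other three terms is there to cancel one of them.\<close>

definition energy :: "real \<Rightarrow> 'a \<Rightarrow> real \<Rightarrow> real" where
  "energy \<kappa> z t = 1/2 * (anchor \<kappa> z t \<bullet> anchor \<kappa> z t)
     + \<kappa> * (\<alpha> - 1 - \<kappa>) / 2 * ((x t - z) \<bullet> (x t - z))
     + \<kappa> * \<eta> * ((x t - z) \<bullet> g t) + \<eta> * (1 - \<eta>) / 2 * (g t \<bullet> g t)"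

lemma x_ac:
  assumes "t0 \<le> r"
  shows "absolutely_continuous_on {r..s} x"
  using sol assms by (simp add: strong_solution_def locally_absolutely_continuous_on_def)

lemma v_ac:
  assumes "t0 \<le> r"
  shows "absolutely_continuous_on {r..s} v"
  using sol assms by (simp add: strong_solution_def locally_absolutely_continuous_on_def)

lemma \<beta>_ac:
  assumes "t0 \<le> r"
  shows "absolutely_continuous_on {r..s} \<beta>"
proof (rule absolutely_continuous_on_C1)
  have sub: "{r..s} \<subseteq> {t0..}" using assms by auto
  show "continuous_on {r..s} \<beta>'" using \<beta>'_cont sub by (rule continuous_on_subset)
  fix t assume "t \<in> {r..s}"
  then have "t0 \<le> t" using assms by simp
  with \<beta>_deriv have "(\<beta> has_real_derivative \<beta>' t) (at t within {t0..})" by blast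
  then show "(\<beta> has_real_derivative \<beta>' t) (at t within {r..s})" using sub by (rule DERIV_subset)
qed

lemma u_ac:
  assumes "t0 \<le> r"
  shows "absolutely_continuous_on {r..s} u"
proof -
  obtain L where "L-lipschitz_on UNIV Q" using Q_lipschitz by blast
  then show ?thesis
    unfolding u_def[abs_def] using x_ac[OF assms] by (rule absolutely_continuous_on_lipschitz_compose)
qed

lemmas ac_scaleR = bounded_bilinear.absolutely_continuous_on[OF bounded_bilinear_scaleR]
lemmas ac_inner = bounded_bilinear.absolutely_continuous_on[OF bounded_bilinear_inner]
lemmas ac_mult = bounded_bilinear.absolutely_continuous_on[OF bounded_bilinear_mult]

lemma energy_ac:
  assumes "t0 \<le> r"
  shows "absolutely_continuous_on {r..s} (energy \<kappa> z)"
proof -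
  have p: "absolutely_continuous_on {r..s} (\<lambda>t. x t - z)"
    using absolutely_continuous_on_add[OF x_ac[OF assms] absolutely_continuous_on_const, of s "- z"] by simp
  have g: "absolutely_continuous_on {r..s} g"
    unfolding g_def by (intro ac_scaleR ac_mult absolutely_continuous_on_ident \<beta>_ac u_ac assms)
  have a: "absolutely_continuous_on {r..s} (anchor \<kappa> z)"
    unfolding anchor_def
    by (intro absolutely_continuous_on_add ac_scaleR absolutely_continuous_on_const
        absolutely_continuous_on_ident v_ac p g assms)
  show ?thesis
    unfolding energy_def
    by (intro absolutely_continuous_on_add ac_mult ac_inner absolutely_continuous_on_const p g a)
qed

lemma x_cont: "continuous_on {t0..} x"
  and v_cont: "continuous_on {t0..} v"
  and u_cont: "continuous_on {t0..} u"
  and \<beta>_cont: "continuous_on {t0..} \<beta>"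
  using x_ac v_ac u_ac \<beta>_ac by (auto intro!: continuous_on_Ici_if_ac)

lemmas cont = x_cont v_cont u_cont \<beta>_cont

text \<open>The identity behind the proof.  By the equation, the derivative of \<open>anchor \<kappa> z\<close> is
\<open>(\<kappa> + 1 - \<alpha>) x' - \<eta> t \<beta> u' - \<eta> (\<alpha> - 1) \<beta> u\<close>; here the choice of \<open>b\<close> and \<open>\<theta>\<close> enters.  The rest is an
expansion of inner products.\<close>

lemma energy_deriv:
  assumes t: "t0 \<le> t"
    and x': "(x has_vector_derivative v t) (at t within {t0..})"
    and v': "(v has_vector_derivative a) (at t within {t0..})"
    and u': "(u has_vector_derivative q) (at t within {t0..})"
    and eq: "a + (\<alpha> / t) *\<^sub>R v t + \<beta> t *\<^sub>R q + b t *\<^sub>R u t = 0"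
  shows "(energy \<kappa> z has_real_derivative
      - (\<alpha> - 1 - \<kappa>) * t * (v t \<bullet> v t + \<beta> t * (v t \<bullet> u t))
      - \<kappa> * \<eta> * ((\<alpha> - 2) * \<beta> t - t * \<beta>' t) * ((x t - z) \<bullet> u t)
      - \<eta> * (1 - \<eta>) * ((\<alpha> - 2) * \<beta> t - t * \<beta>' t) * \<beta> t * t * (u t \<bullet> u t)
      - \<eta> * t\<^sup>2 * \<beta> t * (v t \<bullet> q)) (at t within {t0..})"
proof -
  let ?F = "at t within {t0..}"
  have tp: "t > 0" using t t0 by simp
  have \<beta>1: "(\<beta> has_real_derivative \<beta>' t) ?F" using \<beta>_deriv t by simp
  have p': "((\<lambda>t. x t - z) has_vector_derivative v t) ?F"
    using has_vector_derivative_diff[OF x' has_vector_derivative_const[of z]] by simp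
  define g1 where "g1 = (t * \<beta> t) *\<^sub>R q + (\<beta> t + t * \<beta>' t) *\<^sub>R u t"
  have "((\<lambda>t. t * \<beta> t) has_real_derivative \<beta> t + t * \<beta>' t) ?F"
    by (rule derivative_eq_intros \<beta>1 refl)+ simp
  from has_vector_derivative_scaleR[OF this u']
  have g': "(g has_vector_derivative g1) ?F"
    by (simp add: g_def[abs_def] g1_def)
  define A1 where "A1 = (\<kappa> + 1 - \<alpha>) *\<^sub>R v t - (\<eta> * t * \<beta> t) *\<^sub>R q - (\<eta> * (\<alpha> - 1) * \<beta> t) *\<^sub>R u t"
  have "((\<lambda>t. t *\<^sub>R v t) has_vector_derivative t *\<^sub>R a + 1 *\<^sub>R v t) ?F"
    by (intro has_vector_derivative_scaleR v' DERIV_ident)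
  then have A': "(anchor \<kappa> z has_vector_derivative
      \<kappa> *\<^sub>R v t + (t *\<^sub>R a + 1 *\<^sub>R v t) + (1 - \<eta>) *\<^sub>R g1) ?F"
    unfolding anchor_def[abs_def]
    by (intro has_vector_derivative_add bounded_linear.has_vector_derivative[OF bounded_linear_scaleR_right] p' g')
  have ta: "t *\<^sub>R a = - (\<alpha> *\<^sub>R v t) - (t * \<beta> t) *\<^sub>R q - ((1 - \<eta>) * (t * \<beta>' t) + \<theta> * \<beta> t) *\<^sub>R u t"
  proof -
    have "a = - ((\<alpha> / t) *\<^sub>R v t) - \<beta> t *\<^sub>R q - b t *\<^sub>R u t"
      using eq by (simp add: algebra_simps eq_neg_iff_add_eq_0)
    then have "t *\<^sub>R a = - ((t * (\<alpha> / t)) *\<^sub>R v t) - (t * \<beta> t) *\<^sub>R q - (t * b t) *\<^sub>R u t"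
      by (simp add: scaleR_diff_right)
    moreover have "t * (\<alpha> / t) = \<alpha>" using tp by simp
    moreover have "t * b t = (1 - \<eta>) * (t * \<beta>' t) + \<theta> * \<beta> t"
      using b[rule_format, OF t] tp by (simp add: distrib_left)
    ultimately show ?thesis by simp
  qed
  have "\<kappa> *\<^sub>R v t + (t *\<^sub>R a + 1 *\<^sub>R v t) + (1 - \<eta>) *\<^sub>R g1 = A1"
    unfolding ta g1_def A1_def \<theta> by (simp add: algebra_simps) (simp flip: scaleR_add_left)
  with A' have A1: "(anchor \<kappa> z has_vector_derivative A1) ?F" by simp
  note inner' = bounded_bilinear.has_vector_derivative[OF bounded_bilinear_inner]
  have E: "(energy \<kappa> z has_real_derivative
       1/2 * (anchor \<kappa> z t \<bullet> A1 + A1 \<bullet> anchor \<kappa> z t)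
     + \<kappa> * (\<alpha> - 1 - \<kappa>) / 2 * ((x t - z) \<bullet> v t + v t \<bullet> (x t - z))
     + \<kappa> * \<eta> * ((x t - z) \<bullet> g1 + v t \<bullet> g t) + \<eta> * (1 - \<eta>) / 2 * (g t \<bullet> g1 + g1 \<bullet> g t)) ?F"
    unfolding energy_def[abs_def]
    by (intro DERIV_add DERIV_cmult inner'[OF A1 A1, folded has_real_derivative_iff_has_vector_derivative]
        inner'[OF p' p', folded has_real_derivative_iff_has_vector_derivative]
        inner'[OF p' g', folded has_real_derivative_iff_has_vector_derivative]
        inner'[OF g' g', folded has_real_derivative_iff_has_vector_derivative])
  define p where "p = x t - z"
  define V where "V = v t"
  define U where "U = u t"
  define B where "B = \<beta> t"
  define B' where "B' = \<beta>' t"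
  have c: "v t \<bullet> p = p \<bullet> v t" "u t \<bullet> p = p \<bullet> u t" "q \<bullet> p = p \<bullet> q" "u t \<bullet> v t = v t \<bullet> u t"
     "q \<bullet> v t = v t \<bullet> q" "q \<bullet> u t = u t \<bullet> q"
    by (simp_all add: inner_commute)
  have "1/2 * (anchor \<kappa> z t \<bullet> A1 + A1 \<bullet> anchor \<kappa> z t)
     + \<kappa> * (\<alpha> - 1 - \<kappa>) / 2 * (p \<bullet> v t + v t \<bullet> p)
     + \<kappa> * \<eta> * (p \<bullet> g1 + v t \<bullet> g t) + \<eta> * (1 - \<eta>) / 2 * (g t \<bullet> g1 + g1 \<bullet> g t)
     = - (\<alpha> - 1 - \<kappa>) * t * (v t \<bullet> v t + \<beta> t * (v t \<bullet> u t))
      - \<kappa> * \<eta> * ((\<alpha> - 2) * \<beta> t - t * \<beta>' t) * (p \<bullet> u t)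
      - \<eta> * (1 - \<eta>) * ((\<alpha> - 2) * \<beta> t - t * \<beta>' t) * \<beta> t * t * (u t \<bullet> u t)
      - \<eta> * t\<^sup>2 * \<beta> t * (v t \<bullet> q)"
    unfolding anchor_def p_def[symmetric] A1_def g1_def g_def
      inner_add_left inner_add_right inner_diff_left inner_diff_right inner_scaleR_left
      inner_scaleR_right c
    by algebra
  with E show ?thesis by (simp add: p_def)
qed

lemma pairing_nonneg:
  assumes "z \<in> zer Q"
  shows "0 \<le> (x t - z) \<bullet> u t"
proof -
  have "0 \<le> (Q (x t) - Q z) \<bullet> (x t - z)" using Q_mono by (simp add: monotone_operator_def)
  then show ?thesis using assms by (simp add: zer_def u_def inner_commute)
qed

text \<open>The growth condition on \<open>\<beta>\<close> in the form in which the derivative of the energy contains it.\<close>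

lemma damping_margin:
  assumes "t0 \<le> t"
  shows "\<epsilon> * \<beta> t \<le> (\<alpha> - 2) * \<beta> t - t * \<beta>' t"
proof -
  have "\<beta> t > 0" "\<beta>' t * t / \<beta> t \<le> \<alpha> - 2 - \<epsilon>" using assms \<beta>_pos growth by auto
  then have "\<beta>' t * t \<le> (\<alpha> - 2 - \<epsilon>) * \<beta> t" by (simp add: pos_divide_le_eq)
  then show ?thesis by (simp add: algebra_simps)
qed

text \<open>A lower bound for the rate at which the energy decreases.  It replaces \<open>(\<alpha> - 2) \<beta> - t \<beta>'\<close> by the smaller
\<open>\<epsilon> \<beta>\<close> and omits the nonnegative term with \<open>u'\<close>, which exists only almost everywhere; what remains is continuous.\<close>

definition dissipation :: "real \<Rightarrow> 'a \<Rightarrow> real \<Rightarrow> real" where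
  "dissipation \<kappa> z t = (\<alpha> - 1 - \<kappa>) * t * (v t \<bullet> v t + \<beta> t * (v t \<bullet> u t))
     + \<kappa> * \<eta> * \<epsilon> * (\<beta> t * ((x t - z) \<bullet> u t))
     + \<eta> * (1 - \<eta>) * \<epsilon> * (t * (\<beta> t)\<^sup>2 * (u t \<bullet> u t))"

lemma energy_estimate:
  assumes z: "z \<in> zer Q" and \<kappa>: "0 \<le> \<kappa>" and rs: "t0 \<le> r" "r \<le> s"
  shows "energy \<kappa> z s - energy \<kappa> z r \<le> integral {r..s} (\<lambda>t. - dissipation \<kappa> z t)"
proof (rule absolutely_continuous_le_integral[OF rs(2) energy_ac[OF rs(1)]])
  have sub: "{r..s} \<subseteq> {t0..}" using rs by auto
  show "continuous_on {r..s} (\<lambda>t. - dissipation \<kappa> z t)"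
    unfolding dissipation_def by (intro continuous_intros continuous_on_subset[OF _ sub] cont)
  have "AE t in lborel. t \<ge> t0 \<longrightarrow> (x has_vector_derivative v t) (at t within {t0..})"
    and "AE t in lborel. t \<ge> t0 \<longrightarrow>
        (\<exists>a q. (v has_vector_derivative a) (at t within {t0..}) \<and>
               ((\<lambda>s. Q (x s)) has_vector_derivative q) (at t within {t0..}) \<and>
               a + (\<alpha> / t) *\<^sub>R v t + \<beta> t *\<^sub>R q + b t *\<^sub>R Q (x t) = 0)"
    using sol unfolding strong_solution_def by blast+
  then show "AE t in lborel. t \<in> {r..s} \<longrightarrow>
      (\<exists>D\<le>- dissipation \<kappa> z t. (energy \<kappa> z has_real_derivative D) (at t within {r..s}))"
  proof eventually_elim
    case (elim t)
    show ?case
    proof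
      assume "t \<in> {r..s}"
      then have t: "t0 \<le> t" using rs by simp
      then have tp: "t > 0" using t0 by simp
      have x': "(x has_vector_derivative v t) (at t within {t0..})" using elim(1) t by blast
      obtain a q where v': "(v has_vector_derivative a) (at t within {t0..})"
        and u': "((\<lambda>s. Q (x s)) has_vector_derivative q) (at t within {t0..})"
        and eq: "a + (\<alpha> / t) *\<^sub>R v t + \<beta> t *\<^sub>R q + b t *\<^sub>R u t = 0"
        using elim(2) t unfolding u_def by blast
      define \<delta> where "\<delta> = (\<alpha> - 2) * \<beta> t - t * \<beta>' t"
      have \<delta>: "\<epsilon> * \<beta> t \<le> \<delta>" unfolding \<delta>_def by (rule damping_margin[OF t])
      have \<beta>: "\<beta> t > 0" using \<beta>_pos t by blast
      have "at_right t \<le> at t within {t0..}" using t by (intro at_le) auto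
      then have "at t within {t0..} \<noteq> bot" using trivial_limit_at_right_real[of t] by (metis bot.extremum_unique)
      from monotone_operator_derivative_nonneg[OF Q_mono x' u' this] have vq: "0 \<le> v t \<bullet> q" .
      note E = energy_deriv[OF t x' v' u'[folded u_def] eq, of \<kappa> z, folded \<delta>_def]
      have "\<kappa> * \<eta> * (\<epsilon> * \<beta> t) * ((x t - z) \<bullet> u t) \<le> \<kappa> * \<eta> * \<delta> * ((x t - z) \<bullet> u t)"
        using \<kappa> \<eta> \<delta> pairing_nonneg[OF z, of t] by (intro mult_right_mono mult_left_mono) auto
      moreover have "\<eta> * (1 - \<eta>) * (\<epsilon> * \<beta> t) * \<beta> t * t * (u t \<bullet> u t) \<le> \<eta> * (1 - \<eta>) * \<delta> * \<beta> t * t * (u t \<bullet> u t)"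
        using \<eta> \<delta> \<beta> tp by (intro mult_right_mono mult_left_mono) auto
      moreover have "0 \<le> \<eta> * t\<^sup>2 * \<beta> t * (v t \<bullet> q)" using \<eta> \<beta> vq by simp
      moreover have dis: "dissipation \<kappa> z t = (\<alpha> - 1 - \<kappa>) * t * (v t \<bullet> v t + \<beta> t * (v t \<bullet> u t))
          + \<kappa> * \<eta> * (\<epsilon> * \<beta> t) * ((x t - z) \<bullet> u t) + \<eta> * (1 - \<eta>) * (\<epsilon> * \<beta> t) * \<beta> t * t * (u t \<bullet> u t)"
        unfolding dissipation_def by algebra
      ultimately have "- (\<alpha> - 1 - \<kappa>) * t * (v t \<bullet> v t + \<beta> t * (v t \<bullet> u t))
          - \<kappa> * \<eta> * \<delta> * ((x t - z) \<bullet> u t) - \<eta> * (1 - \<eta>) * \<delta> * \<beta> t * t * (u t \<bullet> u t)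
          - \<eta> * t\<^sup>2 * \<beta> t * (v t \<bullet> q) \<le> - dissipation \<kappa> z t"
        unfolding dis minus_mult_left[symmetric] by linarith
      moreover have "{r..s} \<subseteq> {t0..}" by (rule sub)
      ultimately show "\<exists>D\<le>- dissipation \<kappa> z t. (energy \<kappa> z has_real_derivative D) (at t within {r..s})"
        using DERIV_subset[OF E] by blast
    qed
  qed
qed

lemma g_pairing: "(x t - z) \<bullet> g t = t * \<beta> t * ((x t - z) \<bullet> u t)"
  by (simp add: g_def)

lemma g_pairing_nonneg:
  assumes "z \<in> zer Q" "t0 \<le> t"
  shows "0 \<le> (x t - z) \<bullet> g t"
  using pairing_nonneg[OF assms(1), of t] assms(2) t0 \<beta>_pos by (simp add: g_pairing less_imp_le)

text \<open>Each of the four terms of the energy is nonnegative.\<close>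

lemma energy_lower_bounds:
  assumes z: "z \<in> zer Q" and \<kappa>: "0 \<le> \<kappa>" "\<kappa> \<le> \<alpha> - 1" and t: "t0 \<le> t"
  shows "0 \<le> energy \<kappa> z t"
    and "1/2 * (anchor \<kappa> z t \<bullet> anchor \<kappa> z t) \<le> energy \<kappa> z t"
    and "\<kappa> * \<eta> * ((x t - z) \<bullet> g t) \<le> energy \<kappa> z t"
    and "\<eta> * (1 - \<eta>) / 2 * (g t \<bullet> g t) \<le> energy \<kappa> z t"
proof -
  have "0 \<le> 1/2 * (anchor \<kappa> z t \<bullet> anchor \<kappa> z t)"
    "0 \<le> \<kappa> * (\<alpha> - 1 - \<kappa>) / 2 * ((x t - z) \<bullet> (x t - z))"
    "0 \<le> \<kappa> * \<eta> * ((x t - z) \<bullet> g t)" "0 \<le> \<eta> * (1 - \<eta>) / 2 * (g t \<bullet> g t)"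
    using \<kappa> \<eta> g_pairing_nonneg[OF z t] by auto
  then show "0 \<le> energy \<kappa> z t"
    and "1/2 * (anchor \<kappa> z t \<bullet> anchor \<kappa> z t) \<le> energy \<kappa> z t"
    and "\<kappa> * \<eta> * ((x t - z) \<bullet> g t) \<le> energy \<kappa> z t"
    and "\<eta> * (1 - \<eta>) / 2 * (g t \<bullet> g t) \<le> energy \<kappa> z t"
    unfolding energy_def by linarith+
qed

lemma integrable_Icc_if_continuous_Ici:
  fixes f :: "real \<Rightarrow> real"
  assumes "continuous_on {t0..} f" "t0 \<le> r"
  shows "f integrable_on {r..s}"
  using assms(2) by (intro integrable_continuous_real continuous_on_subset[OF assms(1)]) auto

lemma gap_weight_nonneg: "z \<in> zer Q \<Longrightarrow> t0 \<le> t \<Longrightarrow> 0 \<le> \<beta> t * ((x t - z) \<bullet> u t)"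
  using pairing_nonneg \<beta>_pos by (simp add: less_imp_le)

lemma residual_weight_nonneg: "t0 \<le> t \<Longrightarrow> 0 \<le> t * (\<beta> t)\<^sup>2 * (u t \<bullet> u t)"
  using t0 by simp

lemma velocity_weight_nonneg: "t0 \<le> t \<Longrightarrow> 0 \<le> t * (v t \<bullet> v t)"
  using t0 by simp

lemma weights_cont:
  shows "continuous_on {t0..} (\<lambda>t. \<beta> t * ((x t - z) \<bullet> u t))"
    and "continuous_on {t0..} (\<lambda>t. t * (\<beta> t)\<^sup>2 * (u t \<bullet> u t))"
    and "continuous_on {t0..} (\<lambda>t. t * (v t \<bullet> v t))"
  by (intro continuous_intros cont)+

section \<open>Rates from the critical energy\<close>

text \<open>The dissipation for the critical parameter \<open>\<kappa> = \<alpha> - 1\<close>, where its indefinite part vanishes.\<close>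

definition critical_rate :: "'a \<Rightarrow> real \<Rightarrow> real" where
  "critical_rate z t = (\<alpha> - 1) * \<eta> * \<epsilon> * (\<beta> t * ((x t - z) \<bullet> u t))
      + \<eta> * (1 - \<eta>) * \<epsilon> * (t * (\<beta> t)\<^sup>2 * (u t \<bullet> u t))"

lemma critical_rate_bounds:
  assumes z: "z \<in> zer Q" and t: "t0 \<le> t"
  shows "(\<alpha> - 1) * \<eta> * \<epsilon> * (\<beta> t * ((x t - z) \<bullet> u t)) \<le> critical_rate z t"
    and "\<eta> * (1 - \<eta>) * \<epsilon> * (t * (\<beta> t)\<^sup>2 * (u t \<bullet> u t)) \<le> critical_rate z t"
    and "0 \<le> critical_rate z t"
proof -
  have "0 \<le> (\<alpha> - 1) * \<eta> * \<epsilon>" "0 \<le> \<eta> * (1 - \<eta>) * \<epsilon>" using \<alpha> \<eta> \<epsilon> by auto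
  then have "0 \<le> (\<alpha> - 1) * \<eta> * \<epsilon> * (\<beta> t * ((x t - z) \<bullet> u t))"
    "0 \<le> \<eta> * (1 - \<eta>) * \<epsilon> * (t * (\<beta> t)\<^sup>2 * (u t \<bullet> u t))"
    using gap_weight_nonneg[OF assms] residual_weight_nonneg[OF t] by (simp_all only: mult_nonneg_nonneg)
  then show "(\<alpha> - 1) * \<eta> * \<epsilon> * (\<beta> t * ((x t - z) \<bullet> u t)) \<le> critical_rate z t"
    and "\<eta> * (1 - \<eta>) * \<epsilon> * (t * (\<beta> t)\<^sup>2 * (u t \<bullet> u t)) \<le> critical_rate z t"
    and "0 \<le> critical_rate z t"
    unfolding critical_rate_def by linarith+
qed

lemma critical_rate_integrable:
  assumes "t0 \<le> r"
  shows "critical_rate z integrable_on {r..s}"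
  unfolding critical_rate_def[abs_def]
  by (rule integrable_Icc_if_continuous_Ici[OF _ assms])
    (intro continuous_on_add continuous_on_mult_left weights_cont)

lemma critical_energy_estimate:
  assumes z: "z \<in> zer Q" and rs: "t0 \<le> r" "r \<le> s"
  shows "energy (\<alpha> - 1) z s + integral {r..s} (critical_rate z) \<le> energy (\<alpha> - 1) z r"
proof -
  have "dissipation (\<alpha> - 1) z = critical_rate z"
    by (simp add: dissipation_def critical_rate_def fun_eq_iff)
  then show ?thesis
    using energy_estimate[OF z _ rs, of "\<alpha> - 1"] \<alpha>
    unfolding Henstock_Kurzweil_Integration.integral_neg by simp
qed

lemma critical_energy_nonincreasing:
  assumes z: "z \<in> zer Q" and rs: "t0 \<le> r" "r \<le> s"
  shows "energy (\<alpha> - 1) z s \<le> energy (\<alpha> - 1) z r"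
proof -
  have "0 \<le> integral {r..s} (critical_rate z)"
    using rs by (intro Henstock_Kurzweil_Integration.integral_nonneg critical_rate_integrable critical_rate_bounds(3)[OF z]) auto
  then show ?thesis using critical_energy_estimate[OF assms] by linarith
qed

lemma critical_rate_integral_bounded:
  assumes z: "z \<in> zer Q" and t: "t0 \<le> t"
  shows "integral {t0..t} (critical_rate z) \<le> energy (\<alpha> - 1) z t0"
  using critical_energy_estimate[OF z order_refl t] energy_lower_bounds(1)[OF z _ _ t, of "\<alpha> - 1"] \<alpha> by simp

lemma gap_bigo:
  assumes z: "z \<in> zer Q"
  shows "(\<lambda>t. u t \<bullet> (x t - z)) \<in> O[at_top](\<lambda>t. 1 / (t * \<beta> t))"
proof (rule bigoI)
  define C where "C = energy (\<alpha> - 1) z t0 / ((\<alpha> - 1) * \<eta>)"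
  show "eventually (\<lambda>t. norm (u t \<bullet> (x t - z)) \<le> C * norm (1 / (t * \<beta> t))) at_top"
    using eventually_ge_at_top[of t0]
  proof eventually_elim
    case (elim t)
    have pos: "t * \<beta> t > 0" using elim t0 \<beta>_pos by simp
    have "(\<alpha> - 1) * \<eta> > 0" using \<alpha> \<eta> by simp
    moreover have "(\<alpha> - 1) * \<eta> * (t * \<beta> t * ((x t - z) \<bullet> u t)) \<le> energy (\<alpha> - 1) z t0"
      using energy_lower_bounds(3)[OF z _ _ elim, of "\<alpha> - 1"] critical_energy_nonincreasing[OF z order_refl elim] \<alpha>
      by (simp add: g_pairing)
    ultimately have "t * \<beta> t * ((x t - z) \<bullet> u t) \<le> C" by (simp add: C_def pos_le_divide_eq mult.commute)
    then have "(x t - z) \<bullet> u t \<le> C * (1 / (t * \<beta> t))" using pos by (simp add: pos_le_divide_eq mult.commute)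
    then show ?case using pos pairing_nonneg[OF z, of t] by (simp add: inner_commute)
  qed
qed

lemma residual_bigo:
  assumes z: "z \<in> zer Q"
  shows "(\<lambda>t. norm (u t)) \<in> O[at_top](\<lambda>t. 1 / (t * \<beta> t))"
proof (rule bigoI)
  define C where "C = sqrt (energy (\<alpha> - 1) z t0 / (\<eta> * (1 - \<eta>) / 2))"
  show "eventually (\<lambda>t. norm (norm (u t)) \<le> C * norm (1 / (t * \<beta> t))) at_top"
    using eventually_ge_at_top[of t0]
  proof eventually_elim
    case (elim t)
    have pos: "t * \<beta> t > 0" using elim t0 \<beta>_pos by simp
    have "\<eta> * (1 - \<eta>) / 2 > 0" using \<eta> by simp
    moreover have "\<eta> * (1 - \<eta>) / 2 * (g t \<bullet> g t) \<le> energy (\<alpha> - 1) z t0"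
      using energy_lower_bounds(4)[OF z _ _ elim, of "\<alpha> - 1"] critical_energy_nonincreasing[OF z order_refl elim] \<alpha>
      by simp
    ultimately have "(norm (g t))\<^sup>2 \<le> energy (\<alpha> - 1) z t0 / (\<eta> * (1 - \<eta>) / 2)"
      by (metis mult.commute pos_le_divide_eq power2_norm_eq_inner)
    then have "norm (g t) \<le> C" unfolding C_def by (rule real_le_rsqrt)
    then have "norm (u t) * (t * \<beta> t) \<le> C" using pos by (simp add: g_def mult.commute)
    then have "norm (u t) \<le> C / (t * \<beta> t)" using pos by (simp only: pos_le_divide_eq)
    then show ?case using pos by simp
  qed
qed

section \<open>Positive margin: integrability, convergence, and faster rates\<close>

context
  assumes \<epsilon>_pos: "\<epsilon> > 0"
begin

lemma gap_integral_bounded: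
  assumes z: "z \<in> zer Q" and t: "t0 \<le> t"
  shows "integral {t0..t} (\<lambda>t. \<beta> t * ((x t - z) \<bullet> u t)) \<le> energy (\<alpha> - 1) z t0 / ((\<alpha> - 1) * \<eta> * \<epsilon>)"
proof -
  let ?c = "(\<alpha> - 1) * \<eta> * \<epsilon>"
  have c: "?c > 0" using \<alpha> \<eta> \<epsilon>_pos by simp
  have "?c * integral {t0..t} (\<lambda>t. \<beta> t * ((x t - z) \<bullet> u t)) = integral {t0..t} (\<lambda>t. ?c * (\<beta> t * ((x t - z) \<bullet> u t)))"
    by (rule Henstock_Kurzweil_Integration.integral_mult_right[symmetric])
  also have "\<dots> \<le> integral {t0..t} (critical_rate z)"
    by (intro integral_le critical_rate_integrable critical_rate_bounds(1)[OF z] order_refl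
        integrable_Icc_if_continuous_Ici continuous_on_mult_left weights_cont) auto
  finally show ?thesis
    using c critical_rate_integral_bounded[OF assms] by (simp add: pos_le_divide_eq mult.commute)
qed

lemma residual_integral_bounded:
  assumes z: "z \<in> zer Q" and t: "t0 \<le> t"
  shows "integral {t0..t} (\<lambda>t. t * (\<beta> t)\<^sup>2 * (u t \<bullet> u t)) \<le> energy (\<alpha> - 1) z t0 / (\<eta> * (1 - \<eta>) * \<epsilon>)"
proof -
  let ?c = "\<eta> * (1 - \<eta>) * \<epsilon>"
  have c: "?c > 0" using \<eta> \<epsilon>_pos by simp
  have "?c * integral {t0..t} (\<lambda>t. t * (\<beta> t)\<^sup>2 * (u t \<bullet> u t)) = integral {t0..t} (\<lambda>t. ?c * (t * (\<beta> t)\<^sup>2 * (u t \<bullet> u t)))"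
    by (rule Henstock_Kurzweil_Integration.integral_mult_right[symmetric])
  also have "\<dots> \<le> integral {t0..t} (critical_rate z)"
    by (intro integral_le critical_rate_integrable critical_rate_bounds(2)[OF z] order_refl
        integrable_Icc_if_continuous_Ici continuous_on_mult_left weights_cont) auto
  finally show ?thesis
    using c critical_rate_integral_bounded[OF assms] by (simp add: pos_le_divide_eq mult.commute)
qed

text \<open>For \<open>\<kappa> = 0\<close> the energy contains only \<open>t x'\<close> and \<open>g\<close>.  The cross term in its derivative is absorbed by the
square of \<open>\<parallel>x' + \<beta> u\<parallel>\<close>, at the price of the residual term, whose integral is already controlled.\<close>

lemma kinetic_energy_estimate:
  assumes z: "z \<in> zer Q" and rs: "t0 \<le> r" "r \<le> s"
  shows "energy 0 z s - energy 0 z r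
    \<le> (\<alpha> - 1) / 2 * (integral {r..s} (\<lambda>t. t * (\<beta> t)\<^sup>2 * (u t \<bullet> u t)) - integral {r..s} (\<lambda>t. t * (v t \<bullet> v t)))"
proof -
  have "energy 0 z s - energy 0 z r \<le> integral {r..s} (\<lambda>t. - dissipation 0 z t)"
    by (rule energy_estimate[OF z order_refl rs])
  also have "\<dots> \<le> integral {r..s} (\<lambda>t. (\<alpha> - 1) / 2 * (t * (\<beta> t)\<^sup>2 * (u t \<bullet> u t) - t * (v t \<bullet> v t)))"
  proof (rule integral_le)
    show "(\<lambda>t. - dissipation 0 z t) integrable_on {r..s}"
      unfolding dissipation_def
      by (intro integrable_Icc_if_continuous_Ici[OF _ rs(1)] continuous_intros cont)
    show "(\<lambda>t. (\<alpha> - 1) / 2 * (t * (\<beta> t)\<^sup>2 * (u t \<bullet> u t) - t * (v t \<bullet> v t))) integrable_on {r..s}"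
      by (intro integrable_Icc_if_continuous_Ici[OF _ rs(1)] continuous_on_mult_left continuous_on_diff weights_cont)
    fix t assume "t \<in> {r..s}"
    then have t: "t0 \<le> t" "t > 0" using rs t0 by auto
    have "0 \<le> (v t + \<beta> t *\<^sub>R u t) \<bullet> (v t + \<beta> t *\<^sub>R u t)" by simp
    also have "\<dots> = v t \<bullet> v t + 2 * (\<beta> t * (v t \<bullet> u t)) + (\<beta> t)\<^sup>2 * (u t \<bullet> u t)"
      by (simp add: inner_simps inner_commute power2_eq_square)
    finally have "- (v t \<bullet> v t + \<beta> t * (v t \<bullet> u t)) \<le> ((\<beta> t)\<^sup>2 * (u t \<bullet> u t) - v t \<bullet> v t) / 2"
      by simp
    then have "(\<alpha> - 1) * t * (- (v t \<bullet> v t + \<beta> t * (v t \<bullet> u t)))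
        \<le> (\<alpha> - 1) * t * (((\<beta> t)\<^sup>2 * (u t \<bullet> u t) - v t \<bullet> v t) / 2)"
      using \<alpha> t by (intro mult_left_mono) auto
    also have "\<dots> = (\<alpha> - 1) / 2 * (t * (\<beta> t)\<^sup>2 * (u t \<bullet> u t) - t * (v t \<bullet> v t))"
      by (simp add: algebra_simps diff_divide_distrib)
    finally have "(\<alpha> - 1) * t * (- (v t \<bullet> v t + \<beta> t * (v t \<bullet> u t)))
        \<le> (\<alpha> - 1) / 2 * (t * (\<beta> t)\<^sup>2 * (u t \<bullet> u t) - t * (v t \<bullet> v t))" .
    moreover have "0 \<le> \<eta> * (1 - \<eta>) * \<epsilon> * (t * (\<beta> t)\<^sup>2 * (u t \<bullet> u t))"
      using \<eta> \<epsilon> t by simp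
    ultimately show "- dissipation 0 z t \<le> (\<alpha> - 1) / 2 * (t * (\<beta> t)\<^sup>2 * (u t \<bullet> u t) - t * (v t \<bullet> v t))"
      unfolding dissipation_def mult_minus_right by simp
  qed
  also have "\<dots> = (\<alpha> - 1) / 2 * (integral {r..s} (\<lambda>t. t * (\<beta> t)\<^sup>2 * (u t \<bullet> u t)) - integral {r..s} (\<lambda>t. t * (v t \<bullet> v t)))"
    unfolding Henstock_Kurzweil_Integration.integral_mult_right
    by (subst Henstock_Kurzweil_Integration.integral_diff)
      (rule refl integrable_Icc_if_continuous_Ici[OF _ rs(1)] weights_cont)+
  finally show ?thesis .
qed

lemma velocity_integral_bounded:
  assumes z: "z \<in> zer Q" and t: "t0 \<le> t"
  shows "integral {t0..t} (\<lambda>t. t * (v t \<bullet> v t))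
    \<le> energy (\<alpha> - 1) z t0 / (\<eta> * (1 - \<eta>) * \<epsilon>) + 2 / (\<alpha> - 1) * energy 0 z t0"
proof -
  let ?W = "integral {t0..t} (\<lambda>t. t * (\<beta> t)\<^sup>2 * (u t \<bullet> u t))"
  let ?S = "integral {t0..t} (\<lambda>t. t * (v t \<bullet> v t))"
  have "(\<alpha> - 1) / 2 * (?S - ?W) \<le> energy 0 z t0"
  proof -
    have "(\<alpha> - 1) / 2 * (?W - ?S) = - ((\<alpha> - 1) / 2 * (?S - ?W))" unfolding mult_minus_right[symmetric] by simp
    moreover have "0 \<le> energy 0 z t" using energy_lower_bounds(1)[OF z _ _ t, of 0] \<alpha> by simp
    ultimately show ?thesis using kinetic_energy_estimate[OF z order_refl t] by linarith
  qed
  then have "?S - ?W \<le> 2 / (\<alpha> - 1) * energy 0 z t0" using \<alpha> by (simp add: pos_le_divide_eq pos_divide_le_eq mult.commute)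
  then show ?thesis using residual_integral_bounded[OF z t] by linarith
qed

text \<open>The energy for \<open>\<kappa> = 0\<close> increases by no more than the integral of a multiple of \<open>t \<beta>\<^sup>2 \<parallel>u\<parallel>\<^sup>2\<close>, and it is at most
\<open>t\<close> times the integrable function \<open>t \<parallel>x'\<parallel>\<^sup>2 + 2 t \<beta>\<^sup>2 \<parallel>u\<parallel>\<^sup>2\<close>.\<close>

lemma kinetic_energy_tendsto_zero:
  assumes z: "z \<in> zer Q"
  shows "(energy 0 z \<longlongrightarrow> 0) at_top"
proof (rule tendsto_zero_of_almost_nonincreasing[OF t0])
  let ?w = "\<lambda>t. t * (\<beta> t)\<^sup>2 * (u t \<bullet> u t)"
  let ?s = "\<lambda>t. t * (v t \<bullet> v t)"
  define W where "W = energy (\<alpha> - 1) z t0 / (\<eta> * (1 - \<eta>) * \<epsilon>)"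
  define S where "S = energy (\<alpha> - 1) z t0 / (\<eta> * (1 - \<eta>) * \<epsilon>) + 2 / (\<alpha> - 1) * energy 0 z t0"
  have w: "continuous_on {t0..} ?w" and s: "continuous_on {t0..} ?s"
    by (rule weights_cont)+
  show "0 \<le> energy 0 z t" if "t0 \<le> t" for t
    using energy_lower_bounds(1)[OF z _ _ that, of 0] \<alpha> by simp
  show "continuous_on {t0..} (\<lambda>t. (\<alpha> - 1) / 2 * ?w t)" by (intro continuous_on_mult_left w)
  show "0 \<le> (\<alpha> - 1) / 2 * ?w t" if "t0 \<le> t" for t
    using residual_weight_nonneg[OF that] \<alpha> by simp
  show "integral {t0..t} (\<lambda>t. (\<alpha> - 1) / 2 * ?w t) \<le> (\<alpha> - 1) / 2 * W" if "t0 \<le> t" for t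
    unfolding Henstock_Kurzweil_Integration.integral_mult_right W_def using residual_integral_bounded[OF z that] \<alpha>
    by (intro mult_left_mono) auto
  show "energy 0 z t - energy 0 z r \<le> integral {r..t} (\<lambda>t. (\<alpha> - 1) / 2 * ?w t)"
    if "t0 \<le> r" "r \<le> t" for r t
  proof -
    have "0 \<le> integral {r..t} ?s"
      using that(1) velocity_weight_nonneg by (intro integral_nonneg integrable_Icc_if_continuous_Ici[OF s]) auto
    then have "(\<alpha> - 1) / 2 * (integral {r..t} ?w - integral {r..t} ?s) \<le> (\<alpha> - 1) / 2 * integral {r..t} ?w"
      using \<alpha> by (intro mult_left_mono) auto
    then show ?thesis using kinetic_energy_estimate[OF z that] unfolding Henstock_Kurzweil_Integration.integral_mult_right by linarith
  qed
  show "continuous_on {t0..} (\<lambda>t. ?s t + 2 * ?w t)" by (intro continuous_on_add continuous_on_mult_left w s)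
  show "0 \<le> ?s t + 2 * ?w t" if "t0 \<le> t" for t
    using residual_weight_nonneg[OF that] velocity_weight_nonneg[OF that] by linarith
  show "integral {t0..t} (\<lambda>t. ?s t + 2 * ?w t) \<le> S + 2 * W" if "t0 \<le> t" for t
  proof -
    have "integral {t0..t} (\<lambda>t. ?s t + 2 * ?w t) = integral {t0..t} ?s + integral {t0..t} (\<lambda>t. 2 * ?w t)"
      by (intro Henstock_Kurzweil_Integration.integral_add integrable_Icc_if_continuous_Ici continuous_on_mult_left w s order_refl)
    then show ?thesis
      unfolding Henstock_Kurzweil_Integration.integral_mult_right S_def W_def
      using residual_integral_bounded[OF z that] velocity_integral_bounded[OF z that] by linarith
  qed
  show "energy 0 z t \<le> t * (?s t + 2 * ?w t)" if "t0 \<le> t" for t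
  proof -
    let ?a = "t *\<^sub>R v t" and ?h = "(1 - \<eta>) *\<^sub>R g t"
    have "0 \<le> (?a - ?h) \<bullet> (?a - ?h)" by simp
    then have "(?a + ?h) \<bullet> (?a + ?h) \<le> 2 * (?a \<bullet> ?a) + 2 * (?h \<bullet> ?h)"
      by (simp add: inner_add_left inner_add_right inner_diff_left inner_diff_right inner_commute
          del: inner_scaleR_left inner_scaleR_right inner_ge_zero)
    moreover have "?h \<bullet> ?h \<le> g t \<bullet> g t"
    proof -
      have "(1 - \<eta>) * (1 - \<eta>) * (g t \<bullet> g t) \<le> 1 * (g t \<bullet> g t)"
        using \<eta> by (intro mult_right_mono mult_le_one) auto
      then show ?thesis by simp
    qed
    moreover have "\<eta> * (1 - \<eta>) / 2 * (g t \<bullet> g t) \<le> 1 * (g t \<bullet> g t)"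
      using \<eta> mult_le_one[of \<eta> "1 - \<eta>"] by (intro mult_right_mono) auto
    ultimately have "energy 0 z t \<le> ?a \<bullet> ?a + 2 * (g t \<bullet> g t)"
      unfolding energy_def anchor_def by (simp del: inner_scaleR_left inner_scaleR_right)
    also have "\<dots> = t * (?s t + 2 * ?w t)"
      by (simp add: g_def power2_eq_square algebra_simps)
    finally show ?thesis .
  qed
qed

lemma g_tendsto_zero:
  assumes z: "z \<in> zer Q"
  shows "(g \<longlongrightarrow> 0) at_top"
proof -
  define c where "c = \<eta> * (1 - \<eta>) / 2"
  have c: "c > 0" using \<eta> by (simp add: c_def)
  have "((\<lambda>t. (norm (g t))\<^sup>2) \<longlongrightarrow> 0) at_top"
  proof (rule tendsto_sandwich[OF _ _ tendsto_const])
    show "((\<lambda>t. energy 0 z t / c) \<longlongrightarrow> 0) at_top"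
      using tendsto_divide[OF kinetic_energy_tendsto_zero[OF z] tendsto_const[of c]] c by simp
    show "eventually (\<lambda>t. (norm (g t))\<^sup>2 \<le> energy 0 z t / c) at_top"
      using eventually_ge_at_top[of t0]
    proof eventually_elim
      case (elim t)
      have "c * (norm (g t))\<^sup>2 \<le> energy 0 z t"
        using energy_lower_bounds(4)[OF z _ _ elim, of 0] \<alpha> by (simp add: c_def power2_norm_eq_inner)
      then show ?case using c by (simp add: pos_le_divide_eq mult.commute)
    qed
  qed simp
  from tendsto_real_sqrt[OF this] have "((\<lambda>t. norm (g t)) \<longlongrightarrow> 0) at_top" by simp
  then show ?thesis by (simp add: tendsto_norm_zero_iff)
qed

lemma tv_tendsto_zero:
  assumes z: "z \<in> zer Q"
  shows "((\<lambda>t. t *\<^sub>R v t) \<longlongrightarrow> 0) at_top"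
proof -
  have "((\<lambda>t. (norm (anchor 0 z t))\<^sup>2) \<longlongrightarrow> 0) at_top"
  proof (rule tendsto_sandwich[OF _ _ tendsto_const])
    show "((\<lambda>t. 2 * energy 0 z t) \<longlongrightarrow> 0) at_top"
      using tendsto_mult[OF tendsto_const[of 2] kinetic_energy_tendsto_zero[OF z]] by simp
    show "eventually (\<lambda>t. (norm (anchor 0 z t))\<^sup>2 \<le> 2 * energy 0 z t) at_top"
      using eventually_ge_at_top[of t0]
    proof eventually_elim
      case (elim t)
      show ?case using energy_lower_bounds(2)[OF z _ _ elim, of 0] \<alpha> by (simp add: power2_norm_eq_inner)
    qed
  qed simp
  from tendsto_real_sqrt[OF this] have "((\<lambda>t. norm (anchor 0 z t)) \<longlongrightarrow> 0) at_top" by simp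
  then have "(anchor 0 z \<longlongrightarrow> 0) at_top" by (simp add: tendsto_norm_zero_iff)
  then have "((\<lambda>t. anchor 0 z t - (1 - \<eta>) *\<^sub>R g t) \<longlongrightarrow> 0 - (1 - \<eta>) *\<^sub>R 0) at_top"
    by (intro tendsto_diff tendsto_scaleR tendsto_const g_tendsto_zero[OF z])
  then show ?thesis by (simp add: anchor_def)
qed

text \<open>The critical energy bounds \<open>(\<alpha> - 1) (x t - z) + t x' + (1 - \<eta>) g\<close>, and the last two summands tend to zero.\<close>

lemma trajectory_eventually_bounded:
  assumes z: "z \<in> zer Q"
  obtains B where "eventually (\<lambda>t. norm (x t - z) \<le> B) at_top"
proof -
  define C where "C = sqrt (2 * energy (\<alpha> - 1) z t0)"
  have "((\<lambda>t. norm (t *\<^sub>R v t + (1 - \<eta>) *\<^sub>R g t)) \<longlongrightarrow> norm (0 + (1 - \<eta>) *\<^sub>R 0 :: 'a)) at_top"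
    by (intro tendsto_norm tendsto_add tendsto_scaleR tendsto_const g_tendsto_zero[OF z] tv_tendsto_zero[OF z])
  then have "eventually (\<lambda>t. norm (t *\<^sub>R v t + (1 - \<eta>) *\<^sub>R g t) < 1) at_top"
    by (rule order_tendstoD) simp
  with eventually_ge_at_top[of t0] have "eventually (\<lambda>t. norm (x t - z) \<le> C + 1) at_top"
  proof eventually_elim
    case (elim t)
    have "(norm (anchor (\<alpha> - 1) z t))\<^sup>2 \<le> 2 * energy (\<alpha> - 1) z t0"
      using energy_lower_bounds(2)[OF z _ _ elim(1), of "\<alpha> - 1"]
        critical_energy_nonincreasing[OF z order_refl elim(1)] \<alpha>
      by (simp add: power2_norm_eq_inner)
    then have "norm (anchor (\<alpha> - 1) z t) \<le> C" unfolding C_def by (rule real_le_rsqrt)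
    moreover have "(\<alpha> - 1) *\<^sub>R (x t - z) = anchor (\<alpha> - 1) z t - (t *\<^sub>R v t + (1 - \<eta>) *\<^sub>R g t)"
      by (simp add: anchor_def)
    ultimately have "norm ((\<alpha> - 1) *\<^sub>R (x t - z)) \<le> C + 1"
      using norm_triangle_ineq4[of "anchor (\<alpha> - 1) z t" "t *\<^sub>R v t + (1 - \<eta>) *\<^sub>R g t"] elim(2) by simp
    moreover have "1 * norm (x t - z) \<le> \<bar>\<alpha> - 1\<bar> * norm (x t - z)"
      using \<alpha> by (intro mult_right_mono) auto
    ultimately show ?case by simp
  qed
  then show ?thesis by (rule that)
qed

text \<open>The critical energy converges, and it differs from a multiple of \<open>\<parallel>x t - z\<parallel>\<^sup>2\<close> by inner products that each have
a factor tending to zero, \<open>g\<close> or \<open>t x' + (1 - \<eta>) g\<close>; the other factor is bounded.\<close>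

lemma distance_converges:
  assumes z: "z \<in> zer Q"
  shows "\<exists>l. ((\<lambda>t. (norm (x t - z))\<^sup>2) \<longlongrightarrow> l) at_top"
proof -
  define k where "k = \<alpha> - 1"
  have k: "k > 0" using \<alpha> by (simp add: k_def)
  define r where "r t = t *\<^sub>R v t + (1 - \<eta>) *\<^sub>R g t" for t
  have g0: "(g \<longlongrightarrow> 0) at_top" by (rule g_tendsto_zero[OF z])
  have "(r \<longlongrightarrow> 0 + (1 - \<eta>) *\<^sub>R 0) at_top"
    unfolding r_def[abs_def] by (intro tendsto_intros g0 tv_tendsto_zero[OF z])
  then have r0: "(r \<longlongrightarrow> 0) at_top" by simp
  obtain B where B: "eventually (\<lambda>t. norm (x t - z) \<le> B) at_top"
    using trajectory_eventually_bounded[OF z] .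
  obtain l where l: "(energy k z \<longlongrightarrow> l) at_top"
  proof (rule nonincreasing_convergent_at_top[of t0 "energy k z" 0])
    show "energy k z t \<le> energy k z s" if "t0 \<le> s" "s \<le> t" for s t
      unfolding k_def by (rule critical_energy_nonincreasing[OF z that])
    show "0 \<le> energy k z t" if "t0 \<le> t" for t
      using energy_lower_bounds(1)[OF z _ _ that, of k] k by (simp add: k_def)
  qed
  have "energy k z t = k\<^sup>2 / 2 * (norm (x t - z))\<^sup>2 + k * ((x t - z) \<bullet> r t) + 1/2 * (r t \<bullet> r t)
      + k * \<eta> * ((x t - z) \<bullet> g t) + \<eta> * (1 - \<eta>) / 2 * (g t \<bullet> g t)" for t
  proof -
    have "anchor k z t = k *\<^sub>R (x t - z) + r t" by (simp add: anchor_def r_def)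
    then have "1/2 * (anchor k z t \<bullet> anchor k z t)
       = k\<^sup>2 / 2 * ((x t - z) \<bullet> (x t - z)) + k * ((x t - z) \<bullet> r t) + 1/2 * (r t \<bullet> r t)"
      by (simp add: inner_add_left inner_add_right inner_commute power2_eq_square)
    then show ?thesis by (simp add: energy_def power2_norm_eq_inner k_def)
  qed
  then have eq: "(norm (x t - z))\<^sup>2 = 2 / k\<^sup>2 * (energy k z t - k * ((x t - z) \<bullet> r t) - 1/2 * (r t \<bullet> r t)
      - k * \<eta> * ((x t - z) \<bullet> g t) - \<eta> * (1 - \<eta>) / 2 * (g t \<bullet> g t))" for t
    using k by simp
  have "((\<lambda>t. (norm (x t - z))\<^sup>2) \<longlongrightarrow>
      2 / k\<^sup>2 * (l - k * 0 - 1/2 * (0 \<bullet> (0::'a)) - k * \<eta> * 0 - \<eta> * (1 - \<eta>) / 2 * (0 \<bullet> (0::'a)))) at_top"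
    unfolding eq
    by (intro tendsto_mult tendsto_diff tendsto_inner tendsto_const l r0 g0
        tendsto_inner_bounded_zero[OF r0 B] tendsto_inner_bounded_zero[OF g0 B])
  then show ?thesis by blast
qed

lemma \<beta>_mono:
  assumes "t0 \<le> t"
  shows "\<beta> t0 \<le> \<beta> t"
proof (rule DERIV_nonneg_imp_increasing_open[OF assms])
  show "continuous_on {t0..t} \<beta>" using \<beta>_cont by (rule continuous_on_subset) auto
  fix s assume s: "t0 < s" "s < t"
  then have "\<beta> s > 0" "0 \<le> \<beta>' s * s / \<beta> s" using \<beta>_pos growth by auto
  then have "0 \<le> \<beta>' s" using s t0 by (simp add: zero_le_divide_iff zero_le_mult_iff)
  moreover have "(\<beta> has_real_derivative \<beta>' s) (at s)"
    using \<beta>_deriv[rule_format, of s] s at_within_interior[of s "{t0..}"]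
    by (simp add: interior_Ici[of "t0 - 1"])
  ultimately show "\<exists>y. (\<beta> has_real_derivative y) (at s) \<and> 0 \<le> y" by blast
qed

text \<open>As \<open>\<beta>\<close> does not decrease, \<open>t \<beta>\<close> is bounded away from zero and \<open>g\<close> controls \<open>u\<close>.\<close>

lemma u_tendsto_zero:
  assumes z: "z \<in> zer Q"
  shows "(u \<longlongrightarrow> 0) at_top"
proof (rule tendsto_0_le[OF g_tendsto_zero[OF z], of _ "1 / (t0 * \<beta> t0)"])
  show "eventually (\<lambda>t. norm (u t) \<le> norm (g t) * (1 / (t0 * \<beta> t0))) at_top"
    using eventually_ge_at_top[of t0]
  proof eventually_elim
    case (elim t)
    have pos: "t0 * \<beta> t0 > 0" using t0 \<beta>_pos by simp
    have le: "t0 * \<beta> t0 \<le> t * \<beta> t"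
      using elim t0 \<beta>_mono[OF elim] \<beta>_pos by (intro mult_mono) (auto simp: less_imp_le)
    then have "norm (u t) * (t0 * \<beta> t0) \<le> norm (u t) * (t * \<beta> t)" by (rule mult_left_mono) simp
    also have "\<dots> = norm (g t)" using pos le by (simp add: g_def mult.commute)
    finally show ?case using pos by (simp add: pos_le_divide_eq)
  qed
qed

lemma trajectory_converges_weakly:
  assumes z: "z \<in> zer Q"
  shows "\<exists>y\<in>zer Q. weakly_tendsto x y at_top"
proof (rule opial[OF _ _ distance_converges])
  fix y G assume G: "G \<le> at_top" "G \<noteq> bot" and weak: "weakly_tendsto x y G"
  obtain B where B: "eventually (\<lambda>t. norm (x t - z) \<le> B) at_top"
    using trajectory_eventually_bounded[OF z] .
  have bound: "eventually (\<lambda>t. norm (x t) \<le> norm z + B) G"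
    using filter_leD[OF G(1) B]
  proof eventually_elim
    case (elim t)
    then show ?case using norm_triangle_sub[of "x t" z] by simp
  qed
  have "continuous_on UNIV Q" using Q_lipschitz lipschitz_on_continuous_on by blast
  then show "y \<in> zer Q"
    using tendsto_mono[OF G(1) u_tendsto_zero[OF z]]
    by (intro monotone_operator_demiclosed_zero[OF Q_mono _ G(2) weak bound]) (simp_all add: u_def[abs_def])
qed (use z in auto)

lemma gap_smallo:
  assumes z: "z \<in> zer Q"
  shows "(\<lambda>t. u t \<bullet> (x t - z)) \<in> o[at_top](\<lambda>t. 1 / (t * \<beta> t))"
proof (rule smalloI_tendsto)
  obtain B where B: "eventually (\<lambda>t. norm (x t - z) \<le> B) at_top"
    using trajectory_eventually_bounded[OF z] .
  have "((\<lambda>t. (x t - z) \<bullet> g t) \<longlongrightarrow> 0) at_top"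
    by (rule tendsto_inner_bounded_zero[OF g_tendsto_zero[OF z] B])
  then show "((\<lambda>t. u t \<bullet> (x t - z) / (1 / (t * \<beta> t))) \<longlongrightarrow> 0) at_top"
    by (simp add: g_pairing inner_commute mult.commute)
  show "eventually (\<lambda>t. 1 / (t * \<beta> t) \<noteq> 0) at_top"
    using eventually_ge_at_top[of t0] by eventually_elim (use t0 \<beta>_pos in force)
qed

lemma residual_smallo:
  assumes z: "z \<in> zer Q"
  shows "(\<lambda>t. norm (u t)) \<in> o[at_top](\<lambda>t. 1 / (t * \<beta> t))"
proof (rule smalloI_tendsto)
  have "((\<lambda>t. norm (g t)) \<longlongrightarrow> 0) at_top"
    by (rule tendsto_norm_zero[OF g_tendsto_zero[OF z]])
  moreover have "eventually (\<lambda>t. norm (g t) = norm (u t) / (1 / (t * \<beta> t))) at_top"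
    using eventually_ge_at_top[of t0]
  proof eventually_elim
    case (elim t)
    then have "t * \<beta> t > 0" using t0 \<beta>_pos by simp
    then have "\<bar>t * \<beta> t\<bar> = t * \<beta> t" by (rule abs_of_pos)
    then show ?case by (simp add: g_def del: abs_mult)
  qed
  ultimately show "((\<lambda>t. norm (u t) / (1 / (t * \<beta> t))) \<longlongrightarrow> 0) at_top"
    by (rule Lim_transform_eventually)
  show "eventually (\<lambda>t. 1 / (t * \<beta> t) \<noteq> 0) at_top"
    using eventually_ge_at_top[of t0] by eventually_elim (use t0 \<beta>_pos in force)
qed

lemma velocity_smallo:
  assumes z: "z \<in> zer Q"
  shows "(\<lambda>t. norm (v t)) \<in> o[at_top](\<lambda>t. 1 / t)"
proof (rule smalloI_tendsto)
  have "((\<lambda>t. norm (t *\<^sub>R v t)) \<longlongrightarrow> 0) at_top"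
    by (rule tendsto_norm_zero[OF tv_tendsto_zero[OF z]])
  moreover have "eventually (\<lambda>t. norm (t *\<^sub>R v t) = norm (v t) / (1 / t)) at_top"
    using eventually_gt_at_top[of 0] by eventually_elim simp
  ultimately show "((\<lambda>t. norm (v t) / (1 / t)) \<longlongrightarrow> 0) at_top"
    by (rule Lim_transform_eventually)
  show "eventually (\<lambda>t::real. 1 / t \<noteq> 0) at_top"
    using eventually_gt_at_top[of 0] by eventually_elim simp
qed

lemma weighted_integrability:
  assumes z: "z \<in> zer Q"
  shows "set_integrable lborel {t0..} (\<lambda>t. \<beta> t * ((x t - z) \<bullet> u t))"
    and "set_integrable lborel {t0..} (\<lambda>t. t * (\<beta> t)\<^sup>2 * (u t \<bullet> u t))"
    and "set_integrable lborel {t0..} (\<lambda>t. t * (v t \<bullet> v t))"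
proof -
  show "set_integrable lborel {t0..} (\<lambda>t. \<beta> t * ((x t - z) \<bullet> u t))"
    by (rule set_integrable_Ici_if_bounded_integrals[OF _ gap_weight_nonneg[OF z] gap_integral_bounded[OF z]])
      (rule weights_cont)
  show "set_integrable lborel {t0..} (\<lambda>t. t * (\<beta> t)\<^sup>2 * (u t \<bullet> u t))"
    by (rule set_integrable_Ici_if_bounded_integrals[OF _ residual_weight_nonneg residual_integral_bounded[OF z]])
      (rule weights_cont)
  show "set_integrable lborel {t0..} (\<lambda>t. t * (v t \<bullet> v t))"
    by (rule set_integrable_Ici_if_bounded_integrals[OF _ velocity_weight_nonneg velocity_integral_bounded[OF z]])
      (rule weights_cont)
qed

end

end

section \<open>Convergence of the trajectories\<close>

theorem theorem2p2:
  fixes Q :: "'a::{real_inner, complete_space} \<Rightarrow> 'a"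
    and xs :: 'a
    and t0 \<alpha> \<eta> \<theta> \<epsilon> :: real
    and \<beta> \<beta>' b :: "real \<Rightarrow> real"
    and x v :: "real \<Rightarrow> 'a"
  assumes Q_mono: "monotone_operator Q"
    and Q_lipschitz: "\<exists>L. L-lipschitz_on UNIV Q"
    and xs: "xs \<in> zer Q"
    and t0: "t0 > 0"
    and \<alpha>: "\<alpha> \<ge> 2"
    and \<eta>: "\<eta> \<in> {0<..<1}"
    and \<theta>: "\<theta> = (1 - \<eta>) + \<eta> * (\<alpha> - 1)"
    and \<beta>_pos: "\<forall>t\<ge>t0. \<beta> t > 0"
    and \<beta>_deriv: "\<forall>t\<ge>t0. (\<beta> has_real_derivative \<beta>' t) (at t within {t0..})"
    and \<beta>'_cont: "continuous_on {t0..} \<beta>'"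
    and b: "\<forall>t\<ge>t0. b t = (1 - \<eta>) * \<beta>' t + \<theta> * (\<beta> t / t)"
    and sol: "strong_solution t0 \<alpha> \<beta> b Q x v"
    and \<epsilon>: "\<epsilon> \<in> {0..\<alpha> - 2}"
    and growth: "\<forall>t\<ge>t0. 0 \<le> \<beta>' t * t / \<beta> t \<and> \<beta>' t * t / \<beta> t \<le> \<alpha> - 2 - \<epsilon>"
  shows "(\<lambda>t. Q (x t) \<bullet> (x t - xs)) \<in> O[at_top](\<lambda>t. 1 / (t * \<beta> t)) \<and>
    (\<lambda>t. norm (Q (x t))) \<in> O[at_top](\<lambda>t. 1 / (t * \<beta> t)) \<and>
    (\<alpha> > 2 \<and> \<epsilon> > 0 \<longrightarrow>
      (set_integrable lborel {t0..} (\<lambda>t. \<beta> t * (Q (x t) \<bullet> (x t - xs))) \<and>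
       set_integrable lborel {t0..} (\<lambda>t. t * (\<beta> t)\<^sup>2 * (norm (Q (x t)))\<^sup>2) \<and>
       set_integrable lborel {t0..} (\<lambda>t. t * (norm (v t))\<^sup>2)) \<and>
      (\<exists>z\<in>zer Q. weakly_tendsto x z at_top) \<and>
      ((\<lambda>t. Q (x t) \<bullet> (x t - xs)) \<in> o[at_top](\<lambda>t. 1 / (t * \<beta> t)) \<and>
       (\<lambda>t. norm (Q (x t))) \<in> o[at_top](\<lambda>t. 1 / (t * \<beta> t)) \<and>
       (\<lambda>t. norm (v t)) \<in> o[at_top](\<lambda>t. 1 / t)))"
proof -
  interpret fast_ogda Q t0 \<alpha> \<eta> \<theta> \<epsilon> \<beta> \<beta>' b x v
    by unfold_locales (fact assms)+
  have gap: "Q (x t) \<bullet> (x t - xs) = (x t - xs) \<bullet> u t" for t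
    by (simp add: u_def inner_commute)
  show ?thesis
  proof (intro conjI impI)
    show "(\<lambda>t. Q (x t) \<bullet> (x t - xs)) \<in> O[at_top](\<lambda>t. 1 / (t * \<beta> t))"
      using gap_bigo[OF xs] by (simp add: u_def)
    show "(\<lambda>t. norm (Q (x t))) \<in> O[at_top](\<lambda>t. 1 / (t * \<beta> t))"
      using residual_bigo[OF xs] by (simp add: u_def)
    assume "\<alpha> > 2 \<and> \<epsilon> > 0"
    then have e: "\<epsilon> > 0" by simp
    show "set_integrable lborel {t0..} (\<lambda>t. \<beta> t * (Q (x t) \<bullet> (x t - xs)))"
      using weighted_integrability(1)[OF e xs] by (simp add: gap)
    show "set_integrable lborel {t0..} (\<lambda>t. t * (\<beta> t)\<^sup>2 * (norm (Q (x t)))\<^sup>2)"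
      using weighted_integrability(2)[OF e xs] by (simp add: u_def power2_norm_eq_inner)
    show "set_integrable lborel {t0..} (\<lambda>t. t * (norm (v t))\<^sup>2)"
      using weighted_integrability(3)[OF e xs] by (simp add: power2_norm_eq_inner)
    show "\<exists>z\<in>zer Q. weakly_tendsto x z at_top"
      by (rule trajectory_converges_weakly[OF e xs])
    show "(\<lambda>t. Q (x t) \<bullet> (x t - xs)) \<in> o[at_top](\<lambda>t. 1 / (t * \<beta> t))"
      using gap_smallo[OF e xs] by (simp add: u_def)
    show "(\<lambda>t. norm (Q (x t))) \<in> o[at_top](\<lambda>t. 1 / (t * \<beta> t))"
      using residual_smallo[OF e xs] by (simp add: u_def)
    show "(\<lambda>t. norm (v t)) \<in> o[at_top](\<lambda>t. 1 / t)"
      by (rule velocity_smallo[OF e xs])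
  qed
qed

end
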